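(* Let $\mathcal{L}$ be a Delone set in the locally compact $\sigma$-compact abelian group $G$. Then the following assertions are equivalent: (i) For every $\varphi\in C_c(G)$, the function $f_{\mathcal{L},\varphi}:G\to\mathbb{C}$, $f_{\mathcal{L},\varphi}(t)=\sum_{x\in\mathcal{L}}\varphi(t-x)$, is Bohr almost periodic. (ii) The measure $\delta_{\mathcal{L}}=\sum_{x\in\mathcal{L}}\delta_x$ is strongly almost periodic. (iii) The hull $X(\mathcal{L})$ is a compact abelian (topological) group with neutral element $\mathcal{L}$ and group addition satisfying $(t+\mathcal{L})+(s+\mathcal{L})=(s+t+\mathcal{L})$ for all $t,s\in G$. (iv) The dynamical system $(X(\mathcal{L}),G)$ is equicontinuous.
   Context: Groups are Hausdorff and written additively, with neutral element $e$; $C_c(G)$ denotes the continuous compactly supported complex functions. A subset $A\subset G$ is relatively dense if there is a compact $K\subset G$ with $A+K=G$. A subset $\mathcal{L}\subset G$ is uniformly discrete if there is an open neighborhood $U$ of $e$ with $(x+U)\cap(y+U)=\emptyset$ for all $x\neq y$ in $\mathcal{L}$; it is a Delone set if it is uniformly discrete and relatively dense. Almost periodicity: a bounded continuous function $f$ on $G$ is Bohr almost periodic if for every $\epsilon>0$ the set of $t\in G$ with $\sup_{s\in G}|f(s-t)-f(s)|\le\epsilon$ is relatively dense in $G$. A (complex regular Borel) measure $\nu$ on $G$ is translation bounded if for some (equivalently every) nonempty open relatively compact $V\subset G$ there is $C\ge 0$ with $|\nu|(t+V)\le C$ for all $t\in G$; such a $\nu$ is strongly almost periodic if $\nu*\varphi$,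 $(\nu*\varphi)(s)=\int_G\varphi(s-u)\,d\nu(u)$, is Bohr almost periodic for every $\varphi\in C_c(G)$. Hull: a uniformly discrete set $M\subset G$ is identified with the translation bounded measure $\delta_M=\sum_{x\in M}\delta_x$, where $\delta_x$ is the unit point mass at $x$. The hull $X(\mathcal{L})$ is the closure of $\{\delta_{t+\mathcal{L}}:t\in G\}$ in the vague topology, i.e. the weakest topology on measures making all maps $\mu\mapsto\int\varphi\,d\mu$, $\varphi\in C_c(G)$, continuous; $X(\mathcal{L})$ carries this topology. It is compact Hausdorff, all its elements are of the form $\delta_M$ with $M$ uniformly discrete (and are identified with $M$), and $G$ acts continuously on it by $t\cdot M=t+M$. Equicontinuity: a dynamical system $(X,G)$ with $X$ compact Hausdorff and unique compatible uniform structure $\mathcal{U}$ is equicontinuous if for every $V\in\mathcal{U}$ there is $U\in\mathcal{U}$ such that $(x,y)\in U$ implies $(t\cdot x,t\cdot y)\in V$ for all $t\in G$. *)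

theory Defs
  imports "HOL-Analysis.Analysis" "HOL-Algebra.Group"
begin

text \<open>
  The group is the type \<^typ>\<open>'g\<close>, a Hausdorff topological abelian group; local compactness and
  \<open>\<sigma>\<close>-compactness are explicit hypotheses where they are needed.
\<close>

definition sigma_compact_space :: "'a topology \<Rightarrow> bool" where
  "sigma_compact_space T \<longleftrightarrow>
     (\<exists>K :: nat \<Rightarrow> 'a set. (\<forall>n. compactin T (K n)) \<and> (\<Union>n. K n) = topspace T)"

definition Cc :: "('g::topological_space \<Rightarrow> complex) set" where
  "Cc = {\<phi>. continuous_on UNIV \<phi> \<and> compact (closure {x. \<phi> x \<noteq> 0})}"

definition relatively_dense :: "'g::topological_ab_group_add set \<Rightarrow> bool" where
  "relatively_dense A \<longleftrightarrow> (\<exists>K. compact K \<and> {a + k |a k. a \<in> A \<and> k \<in> K} = UNIV)"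

definition uniformly_discrete :: "'g::topological_ab_group_add set \<Rightarrow> bool" where
  "uniformly_discrete L \<longleftrightarrow>
     (\<exists>U. open U \<and> 0 \<in> U \<and> (\<forall>x\<in>L. \<forall>y\<in>L. x \<noteq> y \<longrightarrow> (+) x ` U \<inter> (+) y ` U = {}))"

definition delone :: "'g::topological_ab_group_add set \<Rightarrow> bool" where
  "delone L \<longleftrightarrow> uniformly_discrete L \<and> relatively_dense L"

definition bohr_almost_periodic :: "('g::topological_ab_group_add \<Rightarrow> complex) \<Rightarrow> bool" where
  "bohr_almost_periodic f \<longleftrightarrow>
     continuous_on UNIV f \<and> bounded (range f) \<and>
     (\<forall>\<epsilon>>0. relatively_dense {t. (SUP s. cmod (f (s - t) - f s)) \<le> \<epsilon>})"


section \<open>Complex regular Borel measures\<close>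

text \<open>
  A measure on a locally compact group may have infinite total variation (for instance
  \<open>\<delta>\<^sub>L\<close> for a Delone set \<open>L\<close> in a noncompact group), so a complex measure cannot assign a
  value to every Borel set.  It is represented by its values on the relatively compact Borel
  sets; the value on all other sets is fixed to be \<open>0\<close>, so that equality of measures is
  equality of functions.
\<close>

definition rc_borel :: "'g::topological_space set set" where
  "rc_borel = {A \<in> sets borel. compact (closure A)}"

text \<open>The value \<open>|\<nu>|(A)\<close> for an arbitrary Borel set \<open>A\<close>.\<close>

definition total_variation :: "('g::topological_space set \<Rightarrow> complex) \<Rightarrow> 'g set \<Rightarrow> ennreal" where
  "total_variation \<nu> A =
     (SUP P \<in> {P. finite P \<and> disjoint P \<and> P \<subseteq> rc_borel \<and> \<Union>P \<subseteq> A}. \<Sum>B\<in>P. ennreal (cmod (\<nu> B)))"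

text \<open>The four clauses after the normalisation: countable additivity, local finiteness and
  regularity of \<open>|\<nu>|\<close> (inner by compact sets and outer by open sets).\<close>

definition complex_measures :: "('g::topological_space set \<Rightarrow> complex) set" where
  "complex_measures = {\<nu>.
     (\<forall>A. A \<notin> rc_borel \<longrightarrow> \<nu> A = 0) \<and>
     (\<forall>F :: nat \<Rightarrow> 'g set. range F \<subseteq> rc_borel \<and> disjoint_family F \<and> (\<Union>n. F n) \<in> rc_borel
        \<longrightarrow> (\<lambda>n. \<nu> (F n)) sums \<nu> (\<Union>n. F n)) \<and>
     (\<forall>K. compact K \<longrightarrow> total_variation \<nu> K < \<infinity>) \<and>
     (\<forall>A\<in>rc_borel. \<forall>\<epsilon>>0. \<exists>K U. compact K \<and> open U \<and> K \<subseteq> A \<and> A \<subseteq> U \<and>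
        total_variation \<nu> (U - K) < \<epsilon>)}"

text \<open>
  The positive variation \<open>\<sigma>\<^sup>+(A) = sup {\<sigma>(B) | B \<subseteq> A}\<close> of a real measure, as a positive
  Borel measure; the negative variation is the positive variation of \<open>-\<sigma>\<close>.  Negative values
  \<open>\<sigma>(B)\<close> are sent to \<open>0\<close> by \<^const>\<open>ennreal\<close>, which does not affect the supremum since
  \<open>B = {}\<close> is admitted.
\<close>

definition positive_variation :: "('g::topological_space set \<Rightarrow> real) \<Rightarrow> 'g measure" where
  "positive_variation \<sigma> =
     measure_of UNIV (sets borel) (\<lambda>A. SUP B \<in> {B \<in> rc_borel. B \<subseteq> A}. ennreal (\<sigma> B))"

text \<open>The integral \<open>\<integral>\<phi> d\<nu>\<close>, via the Jordan decompositions of the real and imaginary part of \<open>\<nu>\<close>.\<close>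

definition complex_integral ::
    "('g::topological_space set \<Rightarrow> complex) \<Rightarrow> ('g \<Rightarrow> complex) \<Rightarrow> complex" where
  "complex_integral \<nu> \<phi> =
     (integral\<^sup>L (positive_variation (\<lambda>B. Re (\<nu> B))) \<phi>
       - integral\<^sup>L (positive_variation (\<lambda>B. - Re (\<nu> B))) \<phi>)
     + \<i> * (integral\<^sup>L (positive_variation (\<lambda>B. Im (\<nu> B))) \<phi>
       - integral\<^sup>L (positive_variation (\<lambda>B. - Im (\<nu> B))) \<phi>)"

definition convolution ::
    "('g::topological_ab_group_add set \<Rightarrow> complex) \<Rightarrow> ('g \<Rightarrow> complex) \<Rightarrow> 'g \<Rightarrow> complex" where
  "convolution \<nu> \<phi> s = complex_integral \<nu> (\<lambda>u. \<phi> (s - u))"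

definition translation_bounded :: "('g::topological_ab_group_add set \<Rightarrow> complex) \<Rightarrow> bool" where
  "translation_bounded \<nu> \<longleftrightarrow> \<nu> \<in> complex_measures \<and>
     (\<exists>V. open V \<and> V \<noteq> {} \<and> compact (closure V) \<and>
        (\<exists>C\<ge>0::real. \<forall>t. total_variation \<nu> ((+) t ` V) \<le> ennreal C))"

definition strongly_almost_periodic :: "('g::topological_ab_group_add set \<Rightarrow> complex) \<Rightarrow> bool" where
  "strongly_almost_periodic \<nu> \<longleftrightarrow>
     translation_bounded \<nu> \<and> (\<forall>\<phi>\<in>Cc. bohr_almost_periodic (convolution \<nu> \<phi>))"

definition point_mass :: "'g::topological_space \<Rightarrow> 'g set \<Rightarrow> complex" where
  "point_mass x A = (if A \<in> rc_borel \<and> x \<in> A then 1 else 0)"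

text \<open>If \<open>M\<close> is uniformly discrete, all sums below have only finitely many nonzero terms.\<close>

definition delta :: "'g::topological_space set \<Rightarrow> 'g set \<Rightarrow> complex" where
  "delta M A = (\<Sum>\<^sub>\<infinity>x\<in>M. point_mass x A)"


section \<open>The hull\<close>

definition vague_topology :: "('g::topological_space set \<Rightarrow> complex) topology" where
  "vague_topology = topology_generated_by
     {{\<nu> \<in> complex_measures. complex_integral \<nu> \<phi> \<in> U} |\<phi> U. \<phi> \<in> Cc \<and> open U}"

definition measure_hull :: "'g::topological_ab_group_add set \<Rightarrow> ('g set \<Rightarrow> complex) set" where
  "measure_hull L = vague_topology closure_of (range (\<lambda>t. delta ((+) t ` L)))"

definition hull_topology :: "'g::topological_ab_group_add set \<Rightarrow> ('g set \<Rightarrow> complex) topology" where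
  "hull_topology L = subtopology vague_topology (measure_hull L)"

text \<open>The translation of measures \<open>(t \<cdot> \<nu>)(A) = \<nu>(-t + A)\<close>; under the identification of \<open>M\<close>
  with \<open>\<delta>\<^sub>M\<close> it is \<open>M \<mapsto> t + M\<close>, see \<open>translate_delta\<close> below.\<close>

definition translate ::
    "'g::topological_ab_group_add \<Rightarrow> ('g set \<Rightarrow> complex) \<Rightarrow> 'g set \<Rightarrow> complex" where
  "translate t \<nu> A = \<nu> ((+) (- t) ` A)"

lemma rc_borel_translate:
  fixes A :: "'g::topological_ab_group_add set"
  assumes "A \<in> rc_borel"
  shows "(+) t ` A \<in> rc_borel"
proof -
  have cont: "continuous_on S ((+) a)" for a :: 'g and S
    by (intro continuous_intros)
  have im: "(+) t ` S = (+) (- t) -` S" for S :: "'g set"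
  proof (intro subset_antisym subsetI)
    fix x assume "x \<in> (+) (- t) -` S"
    then have "- t + x \<in> S" by simp
    moreover have "x = t + (- t + x)" by simp
    ultimately show "x \<in> (+) t ` S" by (rule rev_image_eqI)
  qed auto
  have "(+) (- t) \<in> borel_measurable borel"
    by (intro borel_measurable_continuous_onI cont)
  then have borel: "(+) t ` A \<in> sets borel"
    using assms measurable_sets[of "(+) (- t)" borel borel A] by (simp add: rc_borel_def im)
  have comp: "compact ((+) t ` closure A)"
    using assms by (intro compact_continuous_image cont) (simp add: rc_borel_def)
  have "closed ((+) t ` closure A)"
    unfolding im by (intro closed_vimage cont) simp
  then have "closure ((+) t ` A) \<subseteq> (+) t ` closure A"
    by (intro closure_minimal image_mono closure_subset)
  then have "compact (closure ((+) t ` A))"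
    using compact_Int_closed[OF comp closed_closure, of "(+) t ` A"]
    by (simp add: Int_absorb1)
  with borel show ?thesis by (simp add: rc_borel_def)
qed

lemma translate_delta:
  fixes M :: "'g::topological_ab_group_add set"
  shows "translate t (delta M) = delta ((+) t ` M)"
proof
  fix A :: "'g set"
  have inverse_image: "(+) t ` (+) (- t) ` A = A"
    by (simp add: image_image)
  have rc: "(+) (- t) ` A \<in> rc_borel \<longleftrightarrow> A \<in> rc_borel"
    using rc_borel_translate[of A "- t"] rc_borel_translate[of "(+) (- t) ` A" t] inverse_image by auto
  have mem: "x \<in> (+) (- t) ` A \<longleftrightarrow> t + x \<in> A" for x
  proof
    assume "t + x \<in> A"
    moreover have "x = - t + (t + x)" by simp
    ultimately show "x \<in> (+) (- t) ` A" by (rule rev_image_eqI)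
  qed auto
  have "delta ((+) t ` M) A = (\<Sum>\<^sub>\<infinity>x\<in>M. point_mass (t + x) A)"
    unfolding delta_def by (subst infsum_reindex) (auto simp: o_def)
  then show "translate t (delta M) A = delta ((+) t ` M) A"
    unfolding translate_def delta_def point_mass_def rc mem by (rule sym)
qed

definition compact_abelian_group :: "'a topology \<Rightarrow> 'a monoid \<Rightarrow> bool" where
  "compact_abelian_group T H \<longleftrightarrow>
     comm_group H \<and> carrier H = topspace T \<and> compact_space T \<and> Hausdorff_space T \<and>
     continuous_map (prod_topology T T) T (\<lambda>(x, y). x \<otimes>\<^bsub>H\<^esub> y) \<and>
     continuous_map T T (\<lambda>x. inv\<^bsub>H\<^esub> x)"


section \<open>Equicontinuity\<close>

definition uniform_structure_on :: "'a set \<Rightarrow> ('a \<times> 'a) set set \<Rightarrow> bool" where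
  "uniform_structure_on X \<U> \<longleftrightarrow>
     \<U> \<noteq> {} \<and>
     (\<forall>V\<in>\<U>. Id_on X \<subseteq> V \<and> V \<subseteq> X \<times> X) \<and>
     (\<forall>V\<in>\<U>. \<forall>W. V \<subseteq> W \<and> W \<subseteq> X \<times> X \<longrightarrow> W \<in> \<U>) \<and>
     (\<forall>V\<in>\<U>. \<forall>W\<in>\<U>. V \<inter> W \<in> \<U>) \<and>
     (\<forall>V\<in>\<U>. V\<inverse> \<in> \<U>) \<and>
     (\<forall>V\<in>\<U>. \<exists>W\<in>\<U>. W O W \<subseteq> V)"

definition compatible_uniformity :: "'a topology \<Rightarrow> ('a \<times> 'a) set set \<Rightarrow> bool" where
  "compatible_uniformity T \<U> \<longleftrightarrow>
     uniform_structure_on (topspace T) \<U> \<and>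
     (\<forall>S. openin T S \<longleftrightarrow> S \<subseteq> topspace T \<and> (\<forall>x\<in>S. \<exists>V\<in>\<U>. V `` {x} \<subseteq> S))"

text \<open>On a compact Hausdorff space there is exactly one compatible uniformity, so the
  existential quantifier below only names it.\<close>

definition equicontinuous :: "'a topology \<Rightarrow> ('t \<Rightarrow> 'a \<Rightarrow> 'a) \<Rightarrow> bool" where
  "equicontinuous T act \<longleftrightarrow>
     compact_space T \<and> Hausdorff_space T \<and>
     (\<exists>\<U>. compatible_uniformity T \<U> \<and>
        (\<forall>V\<in>\<U>. \<exists>U\<in>\<U>. \<forall>x y. (x, y) \<in> U \<longrightarrow> (\<forall>t. (act t x, act t y) \<in> V)))"

end

theory Submission
  imports Defs
begin

text \<open>
  The idea is to read every function \<open>f(t) = \<Sum>\<^sub>x \<phi>(t - x)\<close> as a coordinate of the orbit of \<open>L\<close> in its hull: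
  \<open>f(t)\<close> is the integral of the reflected \<open>\<phi>\<close> against the measure of \<open>- t + L\<close> (\<open>orbit_integral\<close>).  Since the
  convolution of \<open>\<delta>\<^sub>L\<close> with \<open>\<phi>\<close> is this same function, (i) and (ii) say the same thing.  The other
  conditions are linked by the circle (i), (iv), (iii), (i).

  From (i) to (iv): the translates of an almost periodic function form a totally bounded set
  (\<open>bohr_totally_bounded\<close>), and translation by \<open>t\<close> acts on the hull through \<open>\<phi>(t + u)\<close>.  So for each \<open>\<phi>\<close>
  finitely many \<open>t\<close> already control, up to \<open>\<epsilon>\<close>, how far all translates of two points of the hull are
  apart as seen by \<open>\<phi>\<close>.

  From (iv) to (iii): equicontinuity makes addition and inversion on the orbit uniformly continuous, so
  they extend to the compact hull, and the group laws persist by density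
  (\<open>group_from_equicontinuous_orbit\<close>).

  From (iii) to (i): \<open>t \<mapsto> t + L\<close> is a homomorphism with dense image in a compact group and \<open>f\<close> factors
  through it.  The elements of a compact group that move a continuous function by less than \<open>\<epsilon>\<close> form a
  neighbourhood of the identity, and finitely many translates of it cover the group
  (\<open>compact_group_finite_translates\<close>).

  All of this needs that the hull is compact and Hausdorff and consists of point measures.  The set of
  all subsets of the group is compact in the Fell topology by Alexander's subbase theorem, the sets
  separated by a fixed neighbourhood of \<open>0\<close> form a closed subset of it, and on this subset \<open>M \<mapsto> \<delta>\<^sub>M\<close> is
  continuous (\<open>continuous_map_fell_integral\<close>).  So the measures \<open>\<delta>\<^sub>M\<close> with \<open>M\<close> separated form a vaguely
  compact set, and the hull is a closed part of it because the vague topology is Hausdorff: a complex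
  regular measure is determined by its integrals (\<open>complex_measure_eqI\<close>, based on the Jordan
  decomposition \<open>positive_variation_diff\<close>).
\<close>

text \<open>Below, \<open>closure_of\<close> is the closure in a topological space; the name is shared with a notion for
  setoids.\<close>

no_notation eq_closure_of (\<open>closure'_of\<index>\<close>)


section \<open>Relatively compact Borel sets and bump functions\<close>

lemma rc_borel_subset_compact:
  fixes A :: "'a::t2_space set"
  assumes "A \<in> sets borel" "A \<subseteq> C" "compact C"
  shows "A \<in> rc_borel"
proof -
  have "closure A \<subseteq> C"
    using assms compact_imp_closed closure_minimal by blast
  then have "compact (closure A)"
    using compact_Int_closed[OF \<open>compact C\<close> closed_closure, of A] by (simp add: Int_absorb1)
  with assms show ?thesis by (simp add: rc_borel_def)
qed

lemma rc_borel_subset: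
  fixes A B :: "'a::t2_space set"
  assumes "A \<in> sets borel" "A \<subseteq> B" "B \<in> rc_borel"
  shows "A \<in> rc_borel"
  using assms rc_borel_subset_compact[of A "closure B"] closure_subset[of B]
  by (auto simp: rc_borel_def)

lemma rc_borel_sets: "A \<in> rc_borel \<Longrightarrow> A \<in> sets borel"
  by (simp add: rc_borel_def)

lemma rc_borel_empty [simp]: "{} \<in> rc_borel"
  by (simp add: rc_borel_def)

lemma rc_borel_Un: "A \<in> rc_borel \<Longrightarrow> B \<in> rc_borel \<Longrightarrow> A \<union> B \<in> rc_borel"
  by (auto simp: rc_borel_def closure_Un)

lemma rc_borel_compact:
  fixes A :: "'a::t2_space set"
  shows "compact A \<Longrightarrow> A \<in> rc_borel"
  by (rule rc_borel_subset_compact[of A A]) (auto simp: compact_imp_closed)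

lemma Hausdorff_space_euclidean_t2: "Hausdorff_space (euclidean :: 'a::t2_space topology)"
  unfolding Hausdorff_space_def using separation_t2 by (auto simp: disjnt_def)

lemma compact_neighbourhood:
  fixes C :: "'a::t2_space set"
  assumes "locally_compact_space (euclidean :: 'a topology)" "compact C"
  obtains W where "open W" "compact (closure W)" "C \<subseteq> W"
proof -
  have "\<forall>x\<in>C. \<exists>U K. open U \<and> compact K \<and> x \<in> U \<and> U \<subseteq> K"
    using assms(1) by (auto simp: locally_compact_space_def)
  then obtain U K where UK: "\<And>x. x \<in> C \<Longrightarrow> open (U x) \<and> compact (K x) \<and> x \<in> U x \<and> U x \<subseteq> K x"
    by metis
  obtain D where D: "D \<subseteq> C" "finite D" "C \<subseteq> (\<Union>x\<in>D. U x)"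
    using compactE_image[OF assms(2), of C U] UK by blast
  define W where "W = (\<Union>x\<in>D. U x)"
  have comp: "compact (\<Union>x\<in>D. K x)"
    using D UK by (intro compact_UN) auto
  have "W \<subseteq> (\<Union>x\<in>D. K x)" unfolding W_def using D UK by blast
  moreover have oW: "open W" unfolding W_def using D UK by blast
  ultimately have "W \<in> rc_borel"
    using comp by (intro rc_borel_subset_compact) auto
  then show thesis
    using that oW D by (auto simp: W_def rc_borel_def)
qed

lemma Cc_continuous: "\<phi> \<in> Cc \<Longrightarrow> continuous_on UNIV \<phi>"
  by (simp add: Cc_def)

lemma CcI:
  fixes \<phi> :: "'a::t2_space \<Rightarrow> complex"
  assumes "continuous_on UNIV \<phi>" "compact C" "\<And>x. x \<notin> C \<Longrightarrow> \<phi> x = 0"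
  shows "\<phi> \<in> Cc"
proof -
  have "{x. \<phi> x \<noteq> 0} \<subseteq> C" using assms(3) by blast
  then have "closure {x. \<phi> x \<noteq> 0} \<subseteq> C"
    using assms(2) by (simp add: closure_minimal compact_imp_closed)
  then have "compact (closure {x. \<phi> x \<noteq> 0})"
    using compact_Int_closed[OF assms(2) closed_closure, of "{x. \<phi> x \<noteq> 0}"] by (simp add: Int_absorb1)
  then show ?thesis using assms(1) by (simp add: Cc_def)
qed

lemma bump_function:
  fixes C :: "'a::t2_space set"
  assumes lc: "locally_compact_space (euclidean :: 'a topology)"
    and "compact C" "open U" "C \<subseteq> U"
  obtains b :: "'a \<Rightarrow> real" where
    "continuous_on UNIV b" "\<And>x. 0 \<le> b x" "\<And>x. b x \<le> 1" "\<And>x. x \<in> C \<Longrightarrow> b x = 1"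
    "\<And>x. x \<notin> U \<Longrightarrow> b x = 0" "(\<lambda>x. complex_of_real (b x)) \<in> Cc"
proof -
  obtain W where W: "open W" "compact (closure W)" "C \<subseteq> W"
    using compact_neighbourhood[OF lc \<open>compact C\<close>] by blast
  have creg: "completely_regular_space (euclidean :: 'a topology)"
    by (intro locally_compact_regular_imp_completely_regular_space lc disjI1 Hausdorff_space_euclidean_t2)
  have "closedin euclidean (- (U \<inter> W))"
    using W assms by (auto simp: closed_open)
  moreover have "disjnt (- (U \<inter> W)) C"
    using W assms by (auto simp: disjnt_def)
  ultimately obtain f where f: "continuous_map euclidean (top_of_set {-1..0::real}) f"
      "f ` C \<subseteq> {-1}" "f ` (- (U \<inter> W)) \<subseteq> {0}"
    using Urysohn_completely_regular_closed_compact[OF _ creg, of "-1" 0 "- (U \<inter> W)" C] \<open>compact C\<close>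
    by auto
  define b where "b x = - f x" for x
  have cont: "continuous_on UNIV b"
    using f(1) unfolding b_def by (auto simp: continuous_map_in_subtopology intro!: continuous_intros)
  have "f x \<in> {-1..0}" for x
    using f(1) by (auto simp: continuous_map_in_subtopology)
  then have bounds: "0 \<le> b x" "b x \<le> 1" for x
    by (auto simp: b_def)
  have zero: "b x = 0" if "x \<notin> U \<inter> W" for x using f(3) that by (auto simp: b_def)
  have "(\<lambda>x. complex_of_real (b x)) \<in> Cc"
  proof (rule CcI[OF _ W(2)])
    show "complex_of_real (b x) = 0" if "x \<notin> closure W" for x
      using that closure_subset[of W] zero[of x] by auto
  qed (use cont in \<open>auto intro!: continuous_intros\<close>)
  moreover have "b x = 1" if "x \<in> C" for x
    using f(2) that by (force simp: b_def)
  ultimately show thesis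
    using that cont bounds zero by blast
qed

lemma Cc_support:
  assumes "\<phi> \<in> Cc"
  obtains C where "compact C" "closed C" "\<And>x. x \<notin> C \<Longrightarrow> \<phi> x = 0"
proof
  show "compact (closure {x. \<phi> x \<noteq> 0})"
    using assms by (simp add: Cc_def)
  show "\<phi> x = 0" if "x \<notin> closure {x. \<phi> x \<noteq> 0}" for x
    using that closure_subset[of "{x. \<phi> x \<noteq> 0}"] by blast
qed auto

lemma Cc_bounded:
  assumes "\<phi> \<in> Cc"
  obtains B where "\<And>x. cmod (\<phi> x) \<le> B" "B \<ge> 0"
proof -
  obtain C where C: "compact C" "closed C" "\<And>x. x \<notin> C \<Longrightarrow> \<phi> x = 0"
    using Cc_support[OF assms] by blast
  have "compact (\<phi> ` C)"
    using assms C by (intro compact_continuous_image) (auto simp: Cc_def intro: continuous_on_subset)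
  then have "bounded (\<phi> ` C)" by (rule compact_imp_bounded)
  then obtain B where B: "\<And>x. x \<in> C \<Longrightarrow> cmod (\<phi> x) \<le> B"
    unfolding bounded_iff by blast
  have "cmod (\<phi> x) \<le> max B 0" for x
    using B[of x] C(3)[of x] by (cases "x \<in> C") auto
  with that[of "max B 0"] show thesis by simp
qed

lemma Cc_translate:
  fixes \<phi> :: "'g::{topological_ab_group_add, t2_space} \<Rightarrow> complex"
  assumes "\<phi> \<in> Cc"
  shows "(\<lambda>u. \<phi> (t + u)) \<in> Cc"
proof -
  obtain C where C: "compact C" "\<And>x. x \<notin> C \<Longrightarrow> \<phi> x = 0" using Cc_support[OF assms] by metis
  show ?thesis
  proof (rule CcI)
    show "continuous_on UNIV (\<lambda>u. \<phi> (t + u))"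
      using Cc_continuous[OF assms] by (rule continuous_on_compose2) (auto intro!: continuous_intros)
    show "compact ((\<lambda>c. c - t) ` C)"
      by (intro compact_continuous_image C continuous_intros)
    show "\<phi> (t + u) = 0" if "u \<notin> (\<lambda>c. c - t) ` C" for u
    proof (rule C(2))
      show "t + u \<notin> C" using that by (auto simp: image_iff dest: bspec[of _ _ "t + u"])
    qed
  qed
qed

lemma Cc_reflect:
  fixes \<phi> :: "'g::{topological_ab_group_add, t2_space} \<Rightarrow> complex"
  assumes "\<phi> \<in> Cc"
  shows "(\<lambda>u. \<phi> (t - u)) \<in> Cc"
proof -
  obtain C where C: "compact C" "\<And>x. x \<notin> C \<Longrightarrow> \<phi> x = 0" using Cc_support[OF assms] by metis
  show ?thesis
  proof (rule CcI)
    show "continuous_on UNIV (\<lambda>u. \<phi> (t - u))"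
      using Cc_continuous[OF assms] by (rule continuous_on_compose2) (auto intro!: continuous_intros)
    show "compact ((\<lambda>c. t - c) ` C)"
      by (intro compact_continuous_image C continuous_intros)
    show "\<phi> (t - u) = 0" if "u \<notin> (\<lambda>c. t - c) ` C" for u
    proof (rule C(2))
      show "t - u \<notin> C" using that by (auto simp: image_iff dest: bspec[of _ _ "t - u"])
    qed
  qed
qed

section \<open>The Jordan decomposition of a complex measure\<close>

text \<open>The real measures to which the positive variation is applied: the real and imaginary part of
  a complex measure and their negatives.\<close>

definition signed_measure :: "('a::topological_space set \<Rightarrow> real) \<Rightarrow> bool" where
  "signed_measure \<sigma> \<longleftrightarrow>
     (\<forall>F :: nat \<Rightarrow> 'a set. range F \<subseteq> rc_borel \<and> disjoint_family F \<and> (\<Union>n. F n) \<in> rc_borel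
        \<longrightarrow> (\<lambda>n. \<sigma> (F n)) sums \<sigma> (\<Union>n. F n)) \<and>
     (\<forall>C. compact C \<longrightarrow> (\<exists>B. \<forall>A\<in>rc_borel. A \<subseteq> C \<longrightarrow> \<bar>\<sigma> A\<bar> \<le> B))"

lemma signed_measure_uminus:
  assumes "signed_measure \<sigma>"
  shows "signed_measure (\<lambda>A. - \<sigma> A)"
  using assms by (auto simp: signed_measure_def intro!: sums_minus)

lemma signed_measure_sums:
  assumes "signed_measure \<sigma>" "range F \<subseteq> rc_borel" "disjoint_family F" "(\<Union>n. F n) \<in> rc_borel"
  shows "(\<lambda>n::nat. \<sigma> (F n)) sums \<sigma> (\<Union>n. F n)"
  using assms unfolding signed_measure_def by blast

lemma signed_measure_bounded:
  assumes "signed_measure \<sigma>" "compact C"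
  obtains c where "\<And>A. A \<in> rc_borel \<Longrightarrow> A \<subseteq> C \<Longrightarrow> \<bar>\<sigma> A\<bar> \<le> c"
proof -
  have "\<exists>c. \<forall>A\<in>rc_borel. A \<subseteq> C \<longrightarrow> \<bar>\<sigma> A\<bar> \<le> c"
    using assms by (simp add: signed_measure_def)
  then show thesis using that by auto
qed

lemma signed_measure_empty:
  assumes "signed_measure \<sigma>"
  shows "\<sigma> {} = 0"
proof -
  have "(\<lambda>n::nat. \<sigma> ({}::'a set)) sums \<sigma> (\<Union>n::nat. {})"
    using assms by (intro signed_measure_sums) (auto simp: disjoint_family_on_def)
  then have "summable (\<lambda>n::nat. \<sigma> ({}::'a set))" by (auto simp: sums_iff)
  then show ?thesis by (simp add: summable_const_iff)
qed

lemma signed_measure_Un: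
  assumes "signed_measure \<sigma>" "A \<in> rc_borel" "B \<in> rc_borel" "A \<inter> B = {}"
  shows "\<sigma> (A \<union> B) = \<sigma> A + \<sigma> B"
proof -
  have "range (binaryset A B) \<subseteq> rc_borel"
    using assms by (auto simp: range_binaryset_eq)
  moreover have "disjoint_family (binaryset A B)"
    using assms by (auto simp: disjoint_family_on_def binaryset_def)
  moreover have U: "(\<Union>n. binaryset A B n) = A \<union> B" by (rule UN_binaryset_eq)
  moreover have "A \<union> B \<in> rc_borel" using assms rc_borel_Un by blast
  ultimately have "(\<lambda>n. \<sigma> (binaryset A B n)) sums \<sigma> (A \<union> B)"
    using assms(1) unfolding signed_measure_def by metis
  moreover have "(\<lambda>n. \<sigma> (binaryset A B n)) sums (\<sigma> A + \<sigma> B)"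
    by (intro binaryset_sums signed_measure_empty assms)
  ultimately show ?thesis by (rule sums_unique2)
qed

lemma sets_positive_variation [simp, measurable_cong]: "sets (positive_variation \<sigma>) = sets borel"
  using sets.sets_measure_of_eq[of borel] by (simp add: positive_variation_def)

lemma space_positive_variation [simp]: "space (positive_variation \<sigma>) = UNIV"
  unfolding positive_variation_def by (simp add: space_measure_of_conv)

text \<open>The supremum in the definition of \<open>positive_variation\<close> is countably additive, so that it is what
  \<open>measure_of\<close> returns: sets \<open>B \<subseteq> A\<close> and \<open>B' \<subseteq> A'\<close> can be joined, which gives superadditivity, and a set
  \<open>B \<subseteq> \<Union>n. F n\<close> can be cut into the pieces \<open>B \<inter> F n\<close>, which gives the reverse inequality.\<close>

lemma emeasure_positive_variation:
  fixes \<sigma> :: "'a::t2_space set \<Rightarrow> real"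
  assumes \<sigma>: "signed_measure \<sigma>" and "A \<in> sets borel"
  shows "emeasure (positive_variation \<sigma>) A = (SUP B \<in> {B \<in> rc_borel. B \<subseteq> A}. ennreal (\<sigma> B))"
proof -
  define p where "p A = (SUP B \<in> {B \<in> rc_borel. B \<subseteq> A}. ennreal (\<sigma> B))" for A
  have ne: "{B \<in> rc_borel. B \<subseteq> A} \<noteq> {}" for A :: "'a set"
    using rc_borel_empty by blast
  have upper: "ennreal (\<sigma> B) \<le> p A" if "B \<in> rc_borel" "B \<subseteq> A" for A B
    unfolding p_def using that by (intro SUP_upper) auto
  have pos: "positive (sets borel) p"
  proof -
    have "{B \<in> rc_borel. B \<subseteq> ({}::'a set)} = {{}}" by auto
    then show ?thesis by (auto simp: positive_def p_def signed_measure_empty[OF \<sigma>])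
  qed
  have mono: "p A \<le> p B" if "A \<subseteq> B" for A B
    unfolding p_def using that by (intro SUP_subset_mono) auto
  have super: "p A + p A' \<le> p (A \<union> A')" if "A \<inter> A' = {}" for A A'
  proof -
    have "ennreal (\<sigma> B) + ennreal (\<sigma> B') \<le> p (A \<union> A')"
      if B: "B \<in> rc_borel" "B \<subseteq> A" "B' \<in> rc_borel" "B' \<subseteq> A'" for B B'
    proof -
      consider "\<sigma> B \<le> 0" | "\<sigma> B' \<le> 0" | "\<sigma> B \<ge> 0" "\<sigma> B' \<ge> 0" by linarith
      then show ?thesis
      proof cases
        case 1
        then show ?thesis using upper[of B' "A \<union> A'"] B by (auto simp: ennreal_neg)
      next
        case 2
        then show ?thesis using upper[of B "A \<union> A'"] B by (auto simp: ennreal_neg)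
      next
        case 3
        have "ennreal (\<sigma> B) + ennreal (\<sigma> B') = ennreal (\<sigma> (B \<union> B'))"
          using 3 B \<open>A \<inter> A' = {}\<close> by (subst signed_measure_Un[OF \<sigma>]) auto
        also have "\<dots> \<le> p (A \<union> A')" using B rc_borel_Un by (intro upper) auto
        finally show ?thesis .
      qed
    qed
    then have "(SUP B' \<in> {B' \<in> rc_borel. B' \<subseteq> A'}. ennreal (\<sigma> B) + ennreal (\<sigma> B')) \<le> p (A \<union> A')"
      if "B \<in> rc_borel" "B \<subseteq> A" for B
      using that by (intro SUP_least) auto
    then have "ennreal (\<sigma> B) + p A' \<le> p (A \<union> A')" if "B \<in> rc_borel" "B \<subseteq> A" for B
      using that unfolding p_def[of A'] by (subst ennreal_SUP_add_right[OF ne]) auto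
    then have "(SUP B \<in> {B \<in> rc_borel. B \<subseteq> A}. ennreal (\<sigma> B) + p A') \<le> p (A \<union> A')"
      by (intro SUP_least) auto
    then show ?thesis
      unfolding p_def[of A] by (subst (asm) ennreal_SUP_add_left[OF ne]) auto
  qed
  have "countably_additive (sets borel) p"
  proof (rule countably_additiveI)
    fix F :: "nat \<Rightarrow> 'a set"
    assume F: "range F \<subseteq> sets borel" "disjoint_family F" "(\<Union>i. F i) \<in> sets borel"
    show "(\<Sum>i. p (F i)) = p (\<Union>i. F i)"
    proof (rule antisym)
      have "(\<Sum>i<n. p (F i)) \<le> p (\<Union>i<n. F i)" for n
      proof (induction n)
        case (Suc n)
        have "(\<Union>i<n. F i) \<inter> F n = {}"
          using disjoint_family_onD[OF F(2), of _ n] by fastforce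
        then have "p (\<Union>i<n. F i) + p (F n) \<le> p (\<Union>i<Suc n. F i)"
          using super[of "\<Union>i<n. F i" "F n"] by (simp add: lessThan_Suc Un_commute)
        with Suc show ?case
          by simp (meson add_right_mono order_trans)
      qed (use pos in \<open>simp add: positive_def\<close>)
      moreover have "p (\<Union>i<n. F i) \<le> p (\<Union>i. F i)" for n
        by (intro mono) auto
      ultimately show "(\<Sum>i. p (F i)) \<le> p (\<Union>i. F i)"
        by (intro suminf_le_const) (auto intro: order_trans)
    next
      show "p (\<Union>i. F i) \<le> (\<Sum>i. p (F i))"
        unfolding p_def[of "\<Union>i. F i"]
      proof (rule SUP_least, clarify)
        fix B assume B: "B \<in> rc_borel" "B \<subseteq> (\<Union>i. F i)"
        define a where "a n = \<sigma> (B \<inter> F n)" for n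
        have rc: "B \<inter> F n \<in> rc_borel" for n
          using B F by (intro rc_borel_subset[OF _ _ B(1)]) (auto simp: rc_borel_sets)
        have eq: "(\<Union>n. B \<inter> F n) = B" using B by auto
        have "(\<lambda>n. a n) sums \<sigma> (\<Union>n. B \<inter> F n)" unfolding a_def
          using rc B(1) F(2) eq
          by (intro signed_measure_sums[OF \<sigma>]) (auto simp: disjoint_family_on_def)
        then have "(\<lambda>n. \<Sum>i<n. a i) \<longlonglongrightarrow> \<sigma> B"
          by (simp only: eq sums_def)
        then have "(\<lambda>n. ennreal (\<Sum>i<n. a i)) \<longlonglongrightarrow> ennreal (\<sigma> B)"
          by (rule tendsto_ennrealI)
        moreover have "ennreal (\<Sum>i<n. a i) \<le> (\<Sum>i. p (F i))" for n
        proof -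
          have "ennreal (\<Sum>i<n. a i) \<le> ennreal (\<Sum>i<n. max 0 (a i))"
            by (intro ennreal_leI sum_mono) auto
          also have "\<dots> = (\<Sum>i<n. ennreal (max 0 (a i)))"
            by (simp add: sum_ennreal)
          also have "\<dots> = (\<Sum>i<n. ennreal (a i))"
            by (intro sum.cong) (auto simp: max_def ennreal_neg)
          also have "\<dots> \<le> (\<Sum>i<n. p (F i))"
            using rc by (intro sum_mono) (auto simp: a_def intro!: upper)
          also have "\<dots> \<le> (\<Sum>i. p (F i))"
            by (intro sum_le_suminf) auto
          finally show ?thesis .
        qed
        ultimately show "ennreal (\<sigma> B) \<le> (\<Sum>i. p (F i))"
          by (intro LIMSEQ_le_const2) auto
      qed
    qed
  qed
  then have "emeasure (positive_variation \<sigma>) A = p A"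
    using pos \<open>A \<in> sets borel\<close>
    by (intro emeasure_measure_of[OF positive_variation_def[of \<sigma>, folded p_def]])
       (auto simp: positive_variation_def[symmetric] p_def[symmetric])
  then show ?thesis by (simp add: p_def)
qed

lemma positive_variation_upper:
  fixes \<sigma> :: "'a::t2_space set \<Rightarrow> real"
  assumes \<sigma>: "signed_measure \<sigma>" and "A \<in> sets borel" "B \<in> rc_borel" "B \<subseteq> A"
  shows "ennreal (\<sigma> B) \<le> emeasure (positive_variation \<sigma>) A"
  using assms by (subst emeasure_positive_variation) (auto intro!: SUP_upper)

lemma positive_variation_least:
  fixes \<sigma> :: "'a::t2_space set \<Rightarrow> real"
  assumes \<sigma>: "signed_measure \<sigma>" and "A \<in> sets borel"
    and "\<And>B. B \<in> rc_borel \<Longrightarrow> B \<subseteq> A \<Longrightarrow> ennreal (\<sigma> B) \<le> c"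
  shows "emeasure (positive_variation \<sigma>) A \<le> c"
  using assms by (subst emeasure_positive_variation) (auto intro!: SUP_least)

lemma positive_variation_finite:
  fixes \<sigma> :: "'a::t2_space set \<Rightarrow> real"
  assumes \<sigma>: "signed_measure \<sigma>" and A: "A \<in> rc_borel"
  shows "emeasure (positive_variation \<sigma>) A < \<infinity>"
proof -
  obtain c where c: "\<And>B. B \<in> rc_borel \<Longrightarrow> B \<subseteq> closure A \<Longrightarrow> \<bar>\<sigma> B\<bar> \<le> c"
    using signed_measure_bounded[OF \<sigma>, of "closure A"] A unfolding rc_borel_def by auto
  have "emeasure (positive_variation \<sigma>) A \<le> ennreal c"
  proof (rule positive_variation_least[OF \<sigma> rc_borel_sets[OF A]])
    fix B assume "B \<in> rc_borel" "B \<subseteq> A"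
    then have "\<bar>\<sigma> B\<bar> \<le> c" using c closure_subset by blast
    then show "ennreal (\<sigma> B) \<le> ennreal c" by (intro ennreal_leI) auto
  qed
  also have "\<dots> < \<infinity>" by simp
  finally show ?thesis .
qed

text \<open>The Jordan decomposition.  For \<open>B \<subseteq> A\<close>, \<open>\<sigma>(B) = \<sigma>(A) - \<sigma>(A - B)\<close> is at most \<open>\<sigma>(A)\<close> plus the negative
  variation of \<open>A\<close>; the supremum over \<open>B\<close> is one inequality, and \<open>-\<sigma>\<close> in place of \<open>\<sigma>\<close> gives the other.\<close>

lemma positive_variation_diff:
  fixes \<sigma> :: "'a::t2_space set \<Rightarrow> real"
  assumes \<sigma>: "signed_measure \<sigma>" and A: "A \<in> rc_borel"
  shows "measure (positive_variation \<sigma>) A - measure (positive_variation (\<lambda>B. - \<sigma> B)) A = \<sigma> A"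
proof -
  have le: "measure (positive_variation \<tau>) A \<le> \<tau> A + measure (positive_variation (\<lambda>B. - \<tau> B)) A"
    if \<tau>: "signed_measure \<tau>" for \<tau>
  proof -
    let ?n = "measure (positive_variation (\<lambda>B. - \<tau> B)) A"
    note m\<tau> = signed_measure_uminus[OF \<tau>]
    have n: "emeasure (positive_variation (\<lambda>B. - \<tau> B)) A = ennreal ?n"
      using positive_variation_finite[OF m\<tau> A] by (intro emeasure_eq_ennreal_measure) auto
    have *: "\<tau> B \<le> \<tau> A + ?n" if B: "B \<in> rc_borel" "B \<subseteq> A" for B
    proof -
      have D: "A - B \<in> rc_borel"
        using A B by (intro rc_borel_subset[OF _ _ A]) (auto simp: rc_borel_sets)
      have "\<tau> A = \<tau> B + \<tau> (A - B)"
        using signed_measure_Un[OF \<tau> B(1) D] B by (simp add: Un_absorb1)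
      moreover have "ennreal (- \<tau> (A - B)) \<le> ennreal ?n"
        using positive_variation_upper[OF m\<tau> _ D, of A] A by (simp add: n rc_borel_sets)
      then have "- \<tau> (A - B) \<le> ?n"
        by (subst (asm) ennreal_le_iff) auto
      ultimately show ?thesis by simp
    qed
    have "emeasure (positive_variation \<tau>) A \<le> ennreal (\<tau> A + ?n)"
      using * A by (intro positive_variation_least[OF \<tau>]) (auto simp: rc_borel_sets ennreal_leI)
    moreover have "0 \<le> \<tau> A + ?n"
      using *[of "{}"] by (simp add: signed_measure_empty[OF \<tau>])
    ultimately show ?thesis
      by (simp add: measure_def enn2real_leI)
  qed
  from le[OF \<sigma>] le[OF signed_measure_uminus[OF \<sigma>]] show ?thesis by simp
qed

lemma cmod_le_total_variation:
  fixes A :: "'a::t2_space set"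
  assumes "B \<in> rc_borel" "B \<subseteq> A"
  shows "ennreal (cmod (\<nu> B)) \<le> total_variation \<nu> A"
proof -
  have "(\<Sum>B\<in>{B}. ennreal (cmod (\<nu> B))) \<le> total_variation \<nu> A"
    unfolding total_variation_def using assms by (intro SUP_upper) auto
  then show ?thesis by simp
qed

lemma signed_measure_complex:
  fixes \<nu> :: "'a::t2_space set \<Rightarrow> complex"
  assumes \<nu>: "\<nu> \<in> complex_measures"
  shows "signed_measure (\<lambda>A. Re (\<nu> A))" "signed_measure (\<lambda>A. Im (\<nu> A))"
proof -
  have bound: "\<exists>c. \<forall>B\<in>rc_borel. B \<subseteq> C \<longrightarrow> cmod (\<nu> B) \<le> c" if "compact C" for C
  proof -
    have "total_variation \<nu> C < \<infinity>" using \<nu> that by (auto simp: complex_measures_def)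
    then obtain c where c: "total_variation \<nu> C = ennreal c" "c \<ge> 0"
      by (cases "total_variation \<nu> C") auto
    have "cmod (\<nu> B) \<le> c" if "B \<in> rc_borel" "B \<subseteq> C" for B
      using cmod_le_total_variation[OF that, of \<nu>] c by simp
    then show ?thesis by blast
  qed
  have additive: "(\<lambda>n. \<nu> (F n)) sums \<nu> (\<Union>n. F n)"
    if "range F \<subseteq> rc_borel \<and> disjoint_family F \<and> (\<Union>n. F n) \<in> rc_borel" for F :: "nat \<Rightarrow> 'a set"
    using \<nu> that by (simp add: complex_measures_def)
  have bound': "\<exists>c. \<forall>B\<in>rc_borel. B \<subseteq> C \<longrightarrow> \<bar>f (\<nu> B)\<bar> \<le> c"
    if C: "compact C" and f: "\<And>z. \<bar>f z\<bar> \<le> cmod z" for f and C :: "'a set"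
  proof -
    obtain c where c: "\<forall>B\<in>rc_borel. B \<subseteq> C \<longrightarrow> cmod (\<nu> B) \<le> c" using bound[OF C] by auto
    have "\<bar>f (\<nu> B)\<bar> \<le> c" if "B \<in> rc_borel" "B \<subseteq> C" for B
      using c that f[of "\<nu> B"] by auto
    then show ?thesis by auto
  qed
  show "signed_measure (\<lambda>A. Re (\<nu> A))"
    unfolding signed_measure_def
    by (intro conjI allI impI sums_Re additive bound' abs_Re_le_cmod) auto
  show "signed_measure (\<lambda>A. Im (\<nu> A))"
    unfolding signed_measure_def
    by (intro conjI allI impI sums_Im additive bound' abs_Im_le_cmod) auto
qed

lemma Cc_integrable:
  fixes \<sigma> :: "'a::t2_space set \<Rightarrow> real"
  assumes \<sigma>: "signed_measure \<sigma>" and \<phi>: "\<phi> \<in> Cc"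
  shows "integrable (positive_variation \<sigma>) \<phi>"
proof -
  obtain C where C: "compact C" "closed C" "\<And>x. x \<notin> C \<Longrightarrow> \<phi> x = 0"
    using Cc_support[OF \<phi>] by blast
  obtain B where B: "\<And>x. cmod (\<phi> x) \<le> B" using Cc_bounded[OF \<phi>] by blast
  have "\<phi> \<in> borel_measurable borel"
    using \<phi> by (intro borel_measurable_continuous_onI Cc_continuous)
  then show ?thesis
    using C B positive_variation_finite[OF \<sigma> rc_borel_compact[OF C(1)]]
    by (intro integrableI_bounded_set[where A = C and B = B]) auto
qed

section \<open>Complex measures are determined by their integrals\<close>

text \<open>The integral of \<open>b\<close> and the measure of \<open>A\<close> both lie between the measures of \<open>K\<close> and of \<open>U\<close>.\<close>

lemma positive_variation_integral_bump:
  fixes \<sigma> :: "'a::t2_space set \<Rightarrow> real"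
  assumes \<sigma>: "signed_measure \<sigma>"
    and sets: "compact K" "K \<subseteq> A" "A \<subseteq> U" "A \<in> rc_borel" "U \<in> rc_borel"
    and b: "(\<lambda>x. complex_of_real (b x)) \<in> Cc" "\<And>x. 0 \<le> b x" "\<And>x. b x \<le> 1"
      "\<And>x. x \<in> K \<Longrightarrow> b x = 1" "\<And>x. x \<notin> U \<Longrightarrow> b x = 0"
    and small: "emeasure (positive_variation \<sigma>) (U - K) \<le> ennreal \<epsilon>" "0 \<le> \<epsilon>"
  shows "cmod (integral\<^sup>L (positive_variation \<sigma>) (\<lambda>x. complex_of_real (b x))
     - complex_of_real (measure (positive_variation \<sigma>) A)) \<le> \<epsilon>"
proof -
  let ?p = "positive_variation \<sigma>"
  have K: "K \<in> rc_borel" by (rule rc_borel_compact[OF sets(1)])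
  have fin: "emeasure ?p B < \<infinity>" if "B \<in> rc_borel" for B
    by (rule positive_variation_finite[OF \<sigma> that])
  have fm: "B \<in> fmeasurable ?p" if "B \<in> rc_borel" for B
    using fin[OF that] that by (intro fmeasurableI) (auto simp: rc_borel_sets)
  have ib: "integrable ?p b"
    using Cc_integrable[OF \<sigma> b(1)] by (simp only: complex_of_real_integrable_eq)
  have ii: "integrable ?p (indicat_real B)" if "B \<in> rc_borel" for B
    using fin[OF that] that by (intro integrable_real_indicator) (auto simp: rc_borel_sets)
  have "measure ?p K = (\<integral>x. indicat_real K x \<partial>?p)" by simp
  also have "\<dots> \<le> integral\<^sup>L ?p b"
    using b by (intro integral_mono ib ii K) (auto simp: indicator_def)
  finally have 1: "measure ?p K \<le> integral\<^sup>L ?p b" .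
  have "integral\<^sup>L ?p b \<le> (\<integral>x. indicat_real U x \<partial>?p)"
    using b by (intro integral_mono ib ii sets) (auto simp: indicator_def)
  then have 2: "integral\<^sup>L ?p b \<le> measure ?p U" by simp
  have 3: "measure ?p K \<le> measure ?p A" "measure ?p A \<le> measure ?p U"
    using sets K
    by (intro measure_mono_fmeasurable[OF _ _ fm]; simp add: rc_borel_sets)+
  have "measure ?p (U - K) = measure ?p U - measure ?p K"
    using sets K fin[of U] by (intro measure_Diff) (auto simp: rc_borel_sets)
  moreover have "measure ?p (U - K) \<le> \<epsilon>"
    using small by (simp add: measure_def enn2real_leI)
  ultimately have "\<bar>integral\<^sup>L ?p b - measure ?p A\<bar> \<le> \<epsilon>"
    using 1 2 3 by linarith
  moreover have "(\<integral>x. complex_of_real (b x) \<partial>?p) - complex_of_real (measure ?p A)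
      = complex_of_real (integral\<^sup>L ?p b - measure ?p A)"
    by simp
  ultimately show ?thesis by (simp only: norm_of_real)
qed

lemma complex_integral_bump:
  fixes \<nu> :: "'a::t2_space set \<Rightarrow> complex"
  assumes \<nu>: "\<nu> \<in> complex_measures"
    and sets: "compact K" "K \<subseteq> A" "A \<subseteq> U" "A \<in> rc_borel" "U \<in> rc_borel"
    and b: "(\<lambda>x. complex_of_real (b x)) \<in> Cc" "\<And>x. 0 \<le> b x" "\<And>x. b x \<le> 1"
      "\<And>x. x \<in> K \<Longrightarrow> b x = 1" "\<And>x. x \<notin> U \<Longrightarrow> b x = 0"
    and small: "total_variation \<nu> (U - K) \<le> ennreal \<epsilon>" "0 \<le> \<epsilon>"
  shows "cmod (complex_integral \<nu> (\<lambda>x. complex_of_real (b x)) - \<nu> A) \<le> 4 * \<epsilon>"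
proof -
  let ?I = "\<lambda>\<sigma>. integral\<^sup>L (positive_variation \<sigma>) (\<lambda>x. complex_of_real (b x))"
  let ?m = "\<lambda>\<sigma>. complex_of_real (measure (positive_variation \<sigma>) A)"
  note signed = signed_measure_complex[OF \<nu>]
  note signed' = signed signed[THEN signed_measure_uminus]
  have UK: "U - K \<in> sets borel"
    using sets by (auto simp: rc_borel_sets compact_imp_closed)
  have est: "cmod (?I \<sigma> - ?m \<sigma>) \<le> \<epsilon>" if \<sigma>: "signed_measure \<sigma>" "\<And>B. \<sigma> B \<le> cmod (\<nu> B)" for \<sigma>
  proof (rule positive_variation_integral_bump[OF \<sigma>(1) sets b _ small(2)])
    have "emeasure (positive_variation \<sigma>) (U - K) \<le> total_variation \<nu> (U - K)"
      by (intro positive_variation_least[OF \<sigma>(1) UK]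
          order_trans[OF ennreal_leI[OF \<sigma>(2)] cmod_le_total_variation])
    with small(1) show "emeasure (positive_variation \<sigma>) (U - K) \<le> ennreal \<epsilon>" by simp
  qed
  have le: "Re z \<le> cmod z" "- Re z \<le> cmod z" "Im z \<le> cmod z" "- Im z \<le> cmod z" for z
    using abs_Re_le_cmod[of z] abs_Im_le_cmod[of z] by linarith+
  have four: "cmod ((w - x) + \<i> * (y - z)) \<le> 4 * \<epsilon>"
    if "cmod w \<le> \<epsilon>" "cmod x \<le> \<epsilon>" "cmod y \<le> \<epsilon>" "cmod z \<le> \<epsilon>" for w x y z
    using that norm_triangle_ineq[of "w - x" "\<i> * (y - z)"] norm_triangle_ineq4[of w x]
      norm_triangle_ineq4[of y z] by (simp add: norm_mult)
  let ?r = "\<lambda>B. Re (\<nu> B)" and ?r' = "\<lambda>B. - Re (\<nu> B)" and ?i = "\<lambda>B. Im (\<nu> B)" and ?i' = "\<lambda>B. - Im (\<nu> B)"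
  note e = est[OF signed'(1) le(1)] est[OF signed'(3) le(2)] est[OF signed'(2) le(3)] est[OF signed'(4) le(4)]
  have "\<nu> A = (?m ?r - ?m ?r') + \<i> * (?m ?i - ?m ?i')"
    unfolding of_real_diff[symmetric] positive_variation_diff[OF signed(1) sets(4)]
      positive_variation_diff[OF signed(2) sets(4)]
    by (simp add: complex_eq_iff)
  then have "complex_integral \<nu> (\<lambda>x. complex_of_real (b x)) - \<nu> A
      = ((?I ?r - ?m ?r) - (?I ?r' - ?m ?r')) + \<i> * ((?I ?i - ?m ?i) - (?I ?i' - ?m ?i'))"
    unfolding complex_integral_def by (simp add: algebra_simps)
  also have "cmod \<dots> \<le> 4 * \<epsilon>" by (rule four) (rule e)+
  finally show ?thesis .
qed

lemma total_variation_mono: "A \<subseteq> B \<Longrightarrow> total_variation \<nu> A \<le> total_variation \<nu> B"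
  unfolding total_variation_def by (intro SUP_subset_mono) auto

text \<open>The uniqueness half of the Riesz representation theorem: by regularity, \<open>\<nu>(A)\<close> is a limit of
  integrals of bump functions that lie between a compact subset and an open superset of \<open>A\<close>.\<close>

lemma complex_measure_eqI:
  fixes \<nu> \<mu> :: "'a::t2_space set \<Rightarrow> complex"
  assumes lc: "locally_compact_space (euclidean :: 'a topology)"
    and \<nu>: "\<nu> \<in> complex_measures" and \<mu>: "\<mu> \<in> complex_measures"
    and eq: "\<And>\<phi>. \<phi> \<in> Cc \<Longrightarrow> complex_integral \<nu> \<phi> = complex_integral \<mu> \<phi>"
  shows "\<nu> = \<mu>"
proof
  fix A :: "'a set"
  show "\<nu> A = \<mu> A"
  proof (cases "A \<in> rc_borel")
    case False
    then show ?thesis using \<nu> \<mu> by (simp add: complex_measures_def)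
  next
    case A: True
    have "cmod (\<nu> A - \<mu> A) \<le> 8 * \<epsilon>" if "\<epsilon> > 0" for \<epsilon> :: real
    proof -
      have reg: "\<exists>K U. compact K \<and> open U \<and> K \<subseteq> A \<and> A \<subseteq> U \<and> total_variation \<rho> (U - K) < ennreal \<epsilon>"
        if "\<rho> \<in> complex_measures" for \<rho>
        using that A \<open>\<epsilon> > 0\<close> unfolding complex_measures_def by (auto simp del: ex_simps)
      obtain K1 U1 where 1: "compact K1" "open U1" "K1 \<subseteq> A" "A \<subseteq> U1" "total_variation \<nu> (U1 - K1) < ennreal \<epsilon>"
        using reg[OF \<nu>] by blast
      obtain K2 U2 where 2: "compact K2" "open U2" "K2 \<subseteq> A" "A \<subseteq> U2" "total_variation \<mu> (U2 - K2) < ennreal \<epsilon>"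
        using reg[OF \<mu>] by blast
      obtain W where W: "open W" "compact (closure W)" "closure A \<subseteq> W"
        using A by (auto simp: rc_borel_def intro: compact_neighbourhood[OF lc])
      define K where "K = K1 \<union> K2"
      define U where "U = U1 \<inter> U2 \<inter> W"
      have K: "compact K" "K \<subseteq> A" unfolding K_def using 1 2 by auto
      have U: "open U" "A \<subseteq> U" unfolding U_def using 1 2 W closure_subset[of A] by auto
      have Urc: "U \<in> rc_borel"
        using U(1) closure_subset W(2) by (intro rc_borel_subset_compact[of U "closure W"]) (auto simp: U_def)
      have "total_variation \<nu> (U - K) \<le> total_variation \<nu> (U1 - K1)"
        by (rule total_variation_mono) (auto simp: U_def K_def)
      with 1 have tv1: "total_variation \<nu> (U - K) \<le> ennreal \<epsilon>" by simp
      have "total_variation \<mu> (U - K) \<le> total_variation \<mu> (U2 - K2)"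
        by (rule total_variation_mono) (auto simp: U_def K_def)
      with 2 have tv2: "total_variation \<mu> (U - K) \<le> ennreal \<epsilon>" by simp
      obtain b where b: "\<And>x. 0 \<le> b x" "\<And>x. b x \<le> 1" "\<And>x. x \<in> K \<Longrightarrow> b x = 1"
          "\<And>x. x \<notin> U \<Longrightarrow> b x = 0" "(\<lambda>x. complex_of_real (b x)) \<in> Cc"
        using bump_function[OF lc K(1) U(1) order_trans[OF K(2) U(2)]] by metis
      let ?b = "\<lambda>x. complex_of_real (b x)"
      have "cmod (complex_integral \<nu> ?b - \<nu> A) \<le> 4 * \<epsilon>" "cmod (complex_integral \<mu> ?b - \<mu> A) \<le> 4 * \<epsilon>"
        using \<open>\<epsilon> > 0\<close>
        by (auto intro!: complex_integral_bump[where K = K and U = U] \<nu> \<mu> K U A Urc b tv1 tv2)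
      moreover have "\<nu> A - \<mu> A = (complex_integral \<mu> ?b - \<mu> A) - (complex_integral \<nu> ?b - \<nu> A)"
        using eq[OF b(5)] by simp
      ultimately show ?thesis
        using norm_triangle_ineq4[of "complex_integral \<mu> ?b - \<mu> A" "complex_integral \<nu> ?b - \<nu> A"] by simp
    qed
    from this[of "cmod (\<nu> A - \<mu> A) / 16"] show ?thesis
      by (cases "\<nu> A = \<mu> A") auto
  qed
qed


section \<open>Point measures of locally finite sets\<close>

text \<open>The property of uniformly discrete sets on which everything about the single measure \<open>\<delta>\<^sub>M\<close> rests:
  it makes \<open>\<delta>\<^sub>M\<close> finite on compact sets, and it is inherited by subsets, which gives regularity.\<close>
definition locally_finite :: "'a::topological_space set \<Rightarrow> bool" where
  "locally_finite M \<longleftrightarrow> (\<forall>C. compact C \<longrightarrow> finite (M \<inter> C))"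

lemma locally_finite_rc:
  assumes "locally_finite M" "A \<in> rc_borel"
  shows "finite (M \<inter> A)"
  using assms closure_subset[of A] finite_subset[of "M \<inter> A" "M \<inter> closure A"]
  by (auto simp: locally_finite_def rc_borel_def)

lemma locally_finite_closed:
  fixes M :: "'a::t2_space set"
  assumes lc: "locally_compact_space (euclidean :: 'a topology)" and M: "locally_finite M"
  shows "closed M"
  unfolding closed_def
proof (rule topological_space_class.openI)
  fix x assume "x \<in> - M"
  then have x: "x \<notin> M" by simp
  obtain U where U: "open U" "compact (closure U)" "x \<in> U"
    using compact_neighbourhood[OF lc compact_insert[OF compact_empty], of x] by (metis insert_subset)
  have "finite (M \<inter> U)"
    using M U(2) closure_subset[of U] finite_subset[of "M \<inter> U" "M \<inter> closure U"]
    by (auto simp: locally_finite_def)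
  then have "open (U - M \<inter> U)"
    using U(1) by (intro open_Diff finite_imp_closed)
  then show "\<exists>T. open T \<and> x \<in> T \<and> T \<subseteq> - M"
    using U x by (intro exI[of _ "U - M \<inter> U"]) auto
qed

lemma delta_eq_card:
  assumes M: "locally_finite M" and "A \<in> rc_borel"
  shows "delta M A = of_nat (card (M \<inter> A))"
proof -
  have "delta M A = (\<Sum>\<^sub>\<infinity>x\<in>M \<inter> A. 1)"
    unfolding delta_def using assms by (intro infsum_cong_neutral) (auto simp: point_mass_def)
  then show ?thesis using locally_finite_rc[OF assms] by simp
qed

lemma delta_not_rc: "A \<notin> rc_borel \<Longrightarrow> delta M A = 0"
  by (simp add: delta_def point_mass_def)

lemma total_variation_delta_le:
  assumes M: "locally_finite M" and "finite (M \<inter> A)"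
  shows "total_variation (delta M) A \<le> of_nat (card (M \<inter> A))"
  unfolding total_variation_def
proof (rule SUP_least, clarify)
  fix P assume P: "finite P" "disjoint P" "P \<subseteq> rc_borel" "\<Union>P \<subseteq> A"
  have fin: "finite (M \<inter> B)" if "B \<in> P" for B
    using assms P that by (auto intro: finite_subset[of _ "M \<inter> A"])
  have "(\<Sum>B\<in>P. ennreal (cmod (delta M B))) = (\<Sum>B\<in>P. of_nat (card (M \<inter> B)))"
    using P by (intro sum.cong) (auto simp: delta_eq_card[OF M] ennreal_of_nat_eq_real_of_nat)
  also have "\<dots> = of_nat (\<Sum>B\<in>P. card (M \<inter> B))" by simp
  also have "(\<Sum>B\<in>P. card (M \<inter> B)) = card (\<Union>B\<in>P. M \<inter> B)"
    using P fin by (subst card_UN_disjoint) (auto simp: disjoint_def)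
  also have "of_nat \<dots> \<le> (of_nat (card (M \<inter> A)) :: ennreal)"
    using P assms by (intro of_nat_mono card_mono) auto
  finally show "(\<Sum>B\<in>P. ennreal (cmod (delta M B))) \<le> of_nat (card (M \<inter> A))" .
qed

lemma delta_complex_measure:
  fixes M :: "'a::t2_space set"
  assumes lc: "locally_compact_space (euclidean :: 'a topology)" and M: "locally_finite M"
  shows "delta M \<in> complex_measures"
  unfolding complex_measures_def
proof (intro CollectI conjI allI impI ballI)
  show "delta M A = 0" if "A \<notin> rc_borel" for A by (rule delta_not_rc[OF that])
next
  fix F :: "nat \<Rightarrow> 'a set"
  assume F: "range F \<subseteq> rc_borel \<and> disjoint_family F \<and> (\<Union>n. F n) \<in> rc_borel"
  have fin: "finite (M \<inter> (\<Union>n. F n))" using F by (intro locally_finite_rc[OF M]) auto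
  have Frc: "F n \<in> rc_borel" for n using F by auto
  define N where "N = {n. M \<inter> F n \<noteq> {}}"
  have "inj_on (\<lambda>n. M \<inter> F n) N"
    using F unfolding inj_on_def N_def disjoint_family_on_def by auto blast
  moreover have "finite ((\<lambda>n. M \<inter> F n) ` N)"
    using fin by (rule finite_subset[rotated, OF finite_Pow_iff[THEN iffD2]]) auto
  ultimately have N: "finite N" using finite_imageD by blast
  have "(\<lambda>n. delta M (F n)) sums (\<Sum>n\<in>N. delta M (F n))"
  proof (rule sums_finite[OF N])
    fix n assume "n \<notin> N"
    then show "delta M (F n) = 0" using Frc by (simp add: N_def delta_eq_card[OF M])
  qed
  also have "(\<Sum>n\<in>N. delta M (F n)) = of_nat (\<Sum>n\<in>N. card (M \<inter> F n))"
    using Frc by (simp add: delta_eq_card[OF M])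
  also have "(\<Sum>n\<in>N. card (M \<inter> F n)) = card (\<Union>n\<in>N. M \<inter> F n)"
    using F N by (subst card_UN_disjoint)
      (auto simp: disjoint_family_on_def intro: locally_finite_rc[OF M])
  also have "(\<Union>n\<in>N. M \<inter> F n) = M \<inter> (\<Union>n. F n)"
    by (auto simp: N_def)
  also have "of_nat (card (M \<inter> (\<Union>n. F n))) = delta M (\<Union>n. F n)"
    using F by (simp add: delta_eq_card[OF M])
  finally show "(\<lambda>n. delta M (F n)) sums delta M (\<Union>n. F n)" .
next
  fix K :: "'a set" assume "compact K"
  then have "finite (M \<inter> K)" using M by (simp add: locally_finite_def)
  then have "total_variation (delta M) K \<le> of_nat (card (M \<inter> K))" by (rule total_variation_delta_le[OF M])
  also have "\<dots> < \<infinity>" by (simp add: ennreal_of_nat_eq_real_of_nat)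
  finally show "total_variation (delta M) K < \<infinity>" .
next
  fix A :: "'a set" and \<epsilon> :: ennreal assume A: "A \<in> rc_borel" and "\<epsilon> > 0"
  define U where "U = - (M - A)"
  have "locally_finite (M - A)"
    using M unfolding locally_finite_def by (auto intro: finite_subset[of _ "M \<inter> C" for C])
  then have "open U" unfolding U_def by (intro open_Compl locally_finite_closed[OF lc])
  moreover have "compact (M \<inter> A)"
    using locally_finite_rc[OF M A] by (rule finite_imp_compact)
  moreover have "M \<inter> (U - M \<inter> A) = {}" by (auto simp: U_def)
  then have "total_variation (delta M) (U - M \<inter> A) = 0"
    using total_variation_delta_le[OF M, of "U - M \<inter> A"] by simp
  ultimately show "\<exists>K U. compact K \<and> open U \<and> K \<subseteq> A \<and> A \<subseteq> U \<and> total_variation (delta M) (U - K) < \<epsilon>"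
    using \<open>\<epsilon> > 0\<close> by (intro exI[of _ "M \<inter> A"] exI[of _ U]) (auto simp: U_def)
qed

lemma positive_variation_nonpos:
  fixes \<sigma> :: "'a::t2_space set \<Rightarrow> real" and \<phi> :: "'a \<Rightarrow> complex"
  assumes \<sigma>: "signed_measure \<sigma>" and "\<And>A. \<sigma> A \<le> 0"
  shows "integral\<^sup>L (positive_variation \<sigma>) \<phi> = 0"
proof -
  have "emeasure (positive_variation \<sigma>) UNIV \<le> 0"
    using assms by (intro positive_variation_least) (auto simp: ennreal_neg)
  then have "UNIV \<in> null_sets (positive_variation \<sigma>)" by (intro null_setsI) auto
  then have "AE x in positive_variation \<sigma>. \<phi> x = 0" by (rule AE_I') auto
  then show ?thesis by (rule integral_eq_zero_AE)
qed

text \<open>Only the positive variation of the real part contributes.  It has mass \<open>1\<close> at each point of \<open>M\<close> and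
  no mass on \<open>C - M\<close>, so that \<open>\<phi>\<close> is almost everywhere a finite sum of point indicators.\<close>

lemma complex_integral_delta_compact:
  fixes M :: "'a::t2_space set"
  assumes lc: "locally_compact_space (euclidean :: 'a topology)" and M: "locally_finite M"
    and \<phi>: "\<phi> \<in> Cc" and C: "compact C" "\<And>x. x \<notin> C \<Longrightarrow> \<phi> x = 0"
  shows "complex_integral (delta M) \<phi> = (\<Sum>x\<in>M \<inter> C. \<phi> x)"
proof -
  note signed = signed_measure_complex[OF delta_complex_measure[OF lc M]]
  have real: "Im (delta M A) = 0" "Re (delta M A) \<ge> 0" for A
    by (cases "A \<in> rc_borel"; simp add: delta_eq_card[OF M] delta_not_rc)+
  define p where "p = positive_variation (\<lambda>A. Re (delta M A))"
  have fin: "finite (M \<inter> C)" using M C by (simp add: locally_finite_def)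
  have null: "C - M \<in> null_sets p"
  proof (rule null_setsI)
    show meas: "C - M \<in> sets p"
      unfolding p_def using C locally_finite_closed[OF lc M] by (auto simp: compact_imp_closed)
    have "ennreal (Re (delta M B)) \<le> 0" if "B \<in> rc_borel" "B \<subseteq> C - M" for B
    proof -
      have "M \<inter> B = {}" using that by auto
      then show ?thesis using that by (simp add: delta_eq_card[OF M])
    qed
    then have "emeasure p (C - M) \<le> 0"
      using meas unfolding p_def by (intro positive_variation_least[OF signed(1)]) auto
    then show "emeasure p (C - M) = 0" by simp
  qed
  have atom: "measure p {x} = 1" "emeasure p {x} < \<infinity>" if "x \<in> M" for x
  proof -
    have rc: "{x} \<in> rc_borel" by (rule rc_borel_compact) simp
    have "emeasure p {x} \<le> 1" unfolding p_def
    proof (rule positive_variation_least[OF signed(1)])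
      fix B assume B: "B \<in> rc_borel" "B \<subseteq> {x}"
      then have "card (M \<inter> B) \<le> card {x}" by (intro card_mono) auto
      then show "ennreal (Re (delta M B)) \<le> 1" using B by (simp add: delta_eq_card[OF M])
    qed auto
    moreover have "1 \<le> emeasure p {x}"
      using positive_variation_upper[OF signed(1) _ rc order_refl] that
      by (simp add: p_def delta_eq_card[OF M rc])
    ultimately have "emeasure p {x} = 1" by (rule antisym)
    then show "measure p {x} = 1" "emeasure p {x} < \<infinity>" by (auto simp: measure_def)
  qed
  have "AE x in p. \<phi> x = (\<Sum>y\<in>M \<inter> C. indicator {y} x *\<^sub>R \<phi> y)"
  proof (rule AE_I'[OF null], clarify)
    fix x assume ne: "\<phi> x \<noteq> (\<Sum>y\<in>M \<inter> C. indicator {y} x *\<^sub>R \<phi> y)"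
    have eq: "(\<Sum>y\<in>M \<inter> C. indicator {y} x *\<^sub>R \<phi> y) = (\<Sum>y\<in>M \<inter> C. if y = x then \<phi> y else 0)"
      by (intro sum.cong) (auto simp: indicator_def)
    show "x \<in> C - M" using ne C(2)[of x] fin unfolding eq by (auto split: if_splits)
  qed
  then have "integral\<^sup>L p \<phi> = (\<integral>x. (\<Sum>y\<in>M \<inter> C. indicator {y} x *\<^sub>R \<phi> y) \<partial>p)"
    using borel_measurable_continuous_onI[OF Cc_continuous[OF \<phi>]] by (intro integral_cong_AE) (simp_all add: p_def)
  also have "\<dots> = (\<Sum>y\<in>M \<inter> C. (\<integral>x. indicator {y} x *\<^sub>R \<phi> y \<partial>p))"
    using atom by (intro Bochner_Integration.integral_sum integrable_scaleR_left integrable_real_indicator)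
      (auto simp: p_def)
  also have "\<dots> = (\<Sum>y\<in>M \<inter> C. \<phi> y)"
    using atom by (intro sum.cong) (auto simp: p_def)
  finally have "integral\<^sup>L p \<phi> = (\<Sum>y\<in>M \<inter> C. \<phi> y)" .
  then show ?thesis
    unfolding complex_integral_def p_def
    using real by (simp add: positive_variation_nonpos signed[THEN signed_measure_uminus] signed)
qed

lemma complex_integral_delta:
  fixes M :: "'a::t2_space set"
  assumes lc: "locally_compact_space (euclidean :: 'a topology)" and M: "locally_finite M"
    and \<phi>: "\<phi> \<in> Cc"
  shows "complex_integral (delta M) \<phi> = (\<Sum>\<^sub>\<infinity>x\<in>M. \<phi> x)"
proof -
  obtain C where C: "compact C" "\<And>x. x \<notin> C \<Longrightarrow> \<phi> x = 0" using Cc_support[OF \<phi>] by metis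
  then have "(\<Sum>\<^sub>\<infinity>x\<in>M. \<phi> x) = (\<Sum>\<^sub>\<infinity>x\<in>M \<inter> C. \<phi> x)"
    by (intro infsum_cong_neutral) auto
  then show ?thesis
    using complex_integral_delta_compact[OF lc M \<phi> C] M C(1) by (simp add: locally_finite_def)
qed


section \<open>The vague topology\<close>

definition vague_ball ::
    "('a::topological_space set \<Rightarrow> complex) \<Rightarrow> ('a \<Rightarrow> complex) set \<Rightarrow> real \<Rightarrow> ('a set \<Rightarrow> complex) set" where
  "vague_ball \<nu> \<Phi> \<epsilon> =
     {\<mu> \<in> complex_measures. \<forall>\<phi>\<in>\<Phi>. cmod (complex_integral \<mu> \<phi> - complex_integral \<nu> \<phi>) < \<epsilon>}"

lemma openin_vague_integral:
  assumes "\<phi> \<in> Cc" "open U"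
  shows "openin vague_topology {\<nu> \<in> complex_measures. complex_integral \<nu> \<phi> \<in> U}"
  unfolding vague_topology_def using assms by (intro topology_generated_by_Basis) blast

lemma topspace_vague [simp]: "topspace vague_topology = complex_measures"
proof -
  have zero: "(\<lambda>_. 0) \<in> Cc" by (simp add: Cc_def)
  have "complex_measures \<subseteq> topspace vague_topology"
    using openin_subset[OF openin_vague_integral[OF zero open_UNIV]] by simp
  then show ?thesis unfolding vague_topology_def by auto
qed

lemma openin_vague_ball:
  assumes "finite \<Phi>" "\<Phi> \<subseteq> Cc"
  shows "openin vague_topology (vague_ball \<nu> \<Phi> \<epsilon>)"
proof -
  have "openin vague_topology
      ((\<Inter>\<phi>\<in>\<Phi>. {\<mu> \<in> complex_measures. complex_integral \<mu> \<phi> \<in> ball (complex_integral \<nu> \<phi>) \<epsilon>})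
        \<inter> topspace vague_topology)"
    using assms by (intro openin_INT openin_vague_integral) auto
  moreover have "((\<Inter>\<phi>\<in>\<Phi>. {\<mu> \<in> complex_measures. complex_integral \<mu> \<phi> \<in> ball (complex_integral \<nu> \<phi>) \<epsilon>})
        \<inter> topspace vague_topology) = vague_ball \<nu> \<Phi> \<epsilon>"
    by (auto simp: vague_ball_def dist_norm norm_minus_commute)
  ultimately show ?thesis by simp
qed

lemma vague_ball_mono:
  "\<Psi> \<subseteq> \<Phi> \<Longrightarrow> \<epsilon> \<le> \<delta> \<Longrightarrow> vague_ball \<nu> \<Phi> \<epsilon> \<subseteq> vague_ball \<nu> \<Psi> \<delta>"
  by (force simp: vague_ball_def)

lemma vague_ball_centre: "\<nu> \<in> complex_measures \<Longrightarrow> \<epsilon> > 0 \<Longrightarrow> \<nu> \<in> vague_ball \<nu> \<Phi> \<epsilon>"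
  by (simp add: vague_ball_def)

text \<open>The sets \<open>vague_ball \<nu> \<Phi> \<epsilon>\<close> form a neighbourhood base: finite intersections of subbasic sets only
  involve finitely many test functions.\<close>

lemma openin_vague_iff:
  "openin vague_topology S \<longleftrightarrow> S \<subseteq> complex_measures \<and>
     (\<forall>\<nu>\<in>S. \<exists>\<Phi> \<epsilon>. finite \<Phi> \<and> \<Phi> \<subseteq> Cc \<and> \<epsilon> > 0 \<and> vague_ball \<nu> \<Phi> \<epsilon> \<subseteq> S)"
proof (intro iffI conjI ballI)
  assume S: "openin vague_topology S"
  then show "S \<subseteq> complex_measures" using openin_subset by fastforce
  fix \<nu> assume "\<nu> \<in> S"
  from S have "generate_topology_on {{\<nu> \<in> complex_measures. complex_integral \<nu> \<phi> \<in> U} |\<phi> U. \<phi> \<in> Cc \<and> open U} S"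
    unfolding vague_topology_def by (rule openin_topology_generated_by)
  then show "\<exists>\<Phi> \<epsilon>. finite \<Phi> \<and> \<Phi> \<subseteq> Cc \<and> \<epsilon> > 0 \<and> vague_ball \<nu> \<Phi> \<epsilon> \<subseteq> S"
    using \<open>\<nu> \<in> S\<close>
  proof (induction rule: generate_topology_on.induct)
    case (Int a b)
    then obtain \<Phi> \<epsilon> \<Psi> \<delta> where a: "finite \<Phi>" "\<Phi> \<subseteq> Cc" "\<epsilon> > 0" "vague_ball \<nu> \<Phi> \<epsilon> \<subseteq> a"
      and b: "finite \<Psi>" "\<Psi> \<subseteq> Cc" "\<delta> > 0" "vague_ball \<nu> \<Psi> \<delta> \<subseteq> b" by auto
    have "vague_ball \<nu> (\<Phi> \<union> \<Psi>) (min \<epsilon> \<delta>) \<subseteq> a \<inter> b"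
      using vague_ball_mono[of \<Phi> "\<Phi> \<union> \<Psi>" "min \<epsilon> \<delta>" \<epsilon> \<nu>] vague_ball_mono[of \<Psi> "\<Phi> \<union> \<Psi>" "min \<epsilon> \<delta>" \<delta> \<nu>]
        a(4) b(4) by auto
    then show ?case using a b by (intro exI[of _ "\<Phi> \<union> \<Psi>"] exI[of _ "min \<epsilon> \<delta>"]) auto
  next
    case (UN K)
    then obtain k where k: "k \<in> K" "\<nu> \<in> k" by auto
    from UN.IH[OF this] k(1) show ?case by (meson Union_upper order_trans)
  next
    case (Basis s)
    then obtain \<phi> U where s: "s = {\<nu> \<in> complex_measures. complex_integral \<nu> \<phi> \<in> U}" "\<phi> \<in> Cc" "open U"
      by blast
    then obtain \<epsilon> where "\<epsilon> > 0" "ball (complex_integral \<nu> \<phi>) \<epsilon> \<subseteq> U"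
      using Basis.prems by (auto simp: open_contains_ball)
    then show ?case using s
      by (intro exI[of _ "{\<phi>}"] exI[of _ \<epsilon>]) (auto simp: vague_ball_def dist_norm norm_minus_commute subset_eq)
  qed simp
next
  assume S: "S \<subseteq> complex_measures \<and>
     (\<forall>\<nu>\<in>S. \<exists>\<Phi> \<epsilon>. finite \<Phi> \<and> \<Phi> \<subseteq> Cc \<and> \<epsilon> > 0 \<and> vague_ball \<nu> \<Phi> \<epsilon> \<subseteq> S)"
  show "openin vague_topology S"
  proof (subst openin_subopen, intro ballI)
    fix \<nu> assume \<nu>: "\<nu> \<in> S"
    then obtain \<Phi> \<epsilon> where "finite \<Phi>" "\<Phi> \<subseteq> Cc" "\<epsilon> > 0" "vague_ball \<nu> \<Phi> \<epsilon> \<subseteq> S"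
      using S by blast
    then show "\<exists>T. openin vague_topology T \<and> \<nu> \<in> T \<and> T \<subseteq> S"
      using S \<nu> by (intro exI[of _ "vague_ball \<nu> \<Phi> \<epsilon>"]) (auto intro: openin_vague_ball vague_ball_centre)
  qed
qed

lemma continuous_map_vague_integral:
  "\<phi> \<in> Cc \<Longrightarrow> continuous_map vague_topology euclidean (\<lambda>\<nu>. complex_integral \<nu> \<phi>)"
  by (auto simp: continuous_map_def intro: openin_vague_integral)

lemma continuous_map_into_vague:
  fixes f :: "'b \<Rightarrow> 'a::topological_space set \<Rightarrow> complex"
  assumes "\<And>x. x \<in> topspace X \<Longrightarrow> f x \<in> complex_measures"
    and "\<And>\<phi>. \<phi> \<in> Cc \<Longrightarrow> continuous_map X euclidean (\<lambda>x. complex_integral (f x) \<phi>)"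
  shows "continuous_map X vague_topology f"
  unfolding vague_topology_def
proof (rule continuous_on_generated_topo)
  fix S :: "('a set \<Rightarrow> complex) set"
  assume "S \<in> {{\<nu> \<in> complex_measures. complex_integral \<nu> \<phi> \<in> U} |\<phi> U. \<phi> \<in> Cc \<and> open U}"
  then obtain \<phi> U where S: "S = {\<nu> \<in> complex_measures. complex_integral \<nu> \<phi> \<in> U}" "\<phi> \<in> Cc" "open U"
    by blast
  have "f -` S \<inter> topspace X = {x \<in> topspace X. complex_integral (f x) \<phi> \<in> U}"
    using assms(1) S(1) by auto
  also have "openin X \<dots>" using assms(2)[OF S(2)] S(3) by (auto simp: continuous_map_def)
  finally show "openin X (f -` S \<inter> topspace X)" .
next
  show "f ` topspace X \<subseteq> \<Union>{{\<nu> :: 'a set \<Rightarrow> complex. \<nu> \<in> complex_measures \<and> complex_integral \<nu> \<phi> \<in> U} |\<phi> U. \<phi> \<in> Cc \<and> open U}"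
    using assms(1) topspace_vague[unfolded vague_topology_def topology_generated_by_topspace] by blast
qed

lemma Hausdorff_vague:
  assumes lc: "locally_compact_space (euclidean :: 'a::t2_space topology)"
  shows "Hausdorff_space (vague_topology :: ('a set \<Rightarrow> complex) topology)"
  unfolding Hausdorff_space_def
proof (intro allI impI, elim conjE)
  fix \<nu> \<mu> :: "'a set \<Rightarrow> complex"
  assume "\<nu> \<in> topspace vague_topology" "\<mu> \<in> topspace vague_topology" and ne: "\<nu> \<noteq> \<mu>"
  then have m: "\<nu> \<in> complex_measures" "\<mu> \<in> complex_measures" by auto
  then obtain \<phi> where \<phi>: "\<phi> \<in> Cc" "complex_integral \<nu> \<phi> \<noteq> complex_integral \<mu> \<phi>"
    using complex_measure_eqI[OF lc m] ne by blast
  obtain U V where UV: "open U" "open V" "complex_integral \<nu> \<phi> \<in> U" "complex_integral \<mu> \<phi> \<in> V" "U \<inter> V = {}"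
    using hausdorff[OF \<phi>(2)] by blast
  show "\<exists>U V. openin vague_topology U \<and> openin vague_topology V \<and> \<nu> \<in> U \<and> \<mu> \<in> V \<and> disjnt U V"
    using m UV
    by (intro exI[of _ "{\<nu> \<in> complex_measures. complex_integral \<nu> \<phi> \<in> U}"]
        exI[of _ "{\<nu> \<in> complex_measures. complex_integral \<nu> \<phi> \<in> V}"] conjI openin_vague_integral \<phi>(1))
      (auto simp: disjnt_def)
qed

definition vague_entourage ::
    "('a::topological_space set \<Rightarrow> complex) set \<Rightarrow> ('a \<Rightarrow> complex) set \<Rightarrow> real
      \<Rightarrow> (('a set \<Rightarrow> complex) \<times> ('a set \<Rightarrow> complex)) set" where
  "vague_entourage X \<Phi> \<epsilon> = {(\<mu>, \<nu>) \<in> X \<times> X. \<nu> \<in> vague_ball \<mu> \<Phi> \<epsilon>}"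

text \<open>The uniformity generated by the pseudometrics \<open>|\<integral>\<phi> d\<mu> - \<integral>\<phi> d\<nu>|\<close>.  Its entourages are finite
  conditions on test functions, the form in which total boundedness delivers equicontinuity.\<close>
definition vague_uniformity ::
    "('a::topological_space set \<Rightarrow> complex) set \<Rightarrow> (('a set \<Rightarrow> complex) \<times> ('a set \<Rightarrow> complex)) set set" where
  "vague_uniformity X =
     {W. W \<subseteq> X \<times> X \<and> (\<exists>\<Phi> \<epsilon>. finite \<Phi> \<and> \<Phi> \<subseteq> Cc \<and> \<epsilon> > 0 \<and> vague_entourage X \<Phi> \<epsilon> \<subseteq> W)}"

lemma vague_entourage_in_uniformity:
  "finite \<Phi> \<Longrightarrow> \<Phi> \<subseteq> Cc \<Longrightarrow> \<epsilon> > 0 \<Longrightarrow> vague_entourage X \<Phi> \<epsilon> \<in> vague_uniformity X"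
  unfolding vague_uniformity_def by (auto simp: vague_entourage_def)

lemma vague_uniformityE:
  assumes "W \<in> vague_uniformity X"
  obtains \<Phi> \<epsilon> where "finite \<Phi>" "\<Phi> \<subseteq> Cc" "\<epsilon> > 0" "vague_entourage X \<Phi> \<epsilon> \<subseteq> W" "W \<subseteq> X \<times> X"
  using assms unfolding vague_uniformity_def by auto

lemma compatible_vague_uniformity:
  assumes X: "X \<subseteq> complex_measures"
  shows "compatible_uniformity (subtopology vague_topology X) (vague_uniformity X)"
proof -
  have top: "topspace (subtopology vague_topology X) = X" using X by auto
  have slice: "vague_entourage X \<Phi> \<epsilon> `` {\<nu>} = X \<inter> vague_ball \<nu> \<Phi> \<epsilon>" if "\<nu> \<in> X" for \<nu> \<Phi> \<epsilon>
    using that by (auto simp: vague_entourage_def)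
  have "uniform_structure_on X (vague_uniformity X)"
    unfolding uniform_structure_on_def
  proof (intro conjI ballI allI impI)
    show "vague_uniformity X \<noteq> {}"
      using vague_entourage_in_uniformity[of "{}" 1 X] by auto
  next
    fix V assume "V \<in> vague_uniformity X"
    then obtain \<Phi> \<epsilon> where V: "finite \<Phi>" "\<Phi> \<subseteq> Cc" "\<epsilon> > 0" "vague_entourage X \<Phi> \<epsilon> \<subseteq> V" "V \<subseteq> X \<times> X"
      by (rule vague_uniformityE)
    show "V \<subseteq> X \<times> X" by (rule V(5))
    have "Id_on X \<subseteq> vague_entourage X \<Phi> \<epsilon>"
      using X V(3) by (auto simp: vague_entourage_def vague_ball_def)
    then show "Id_on X \<subseteq> V" using V(4) by (rule order_trans)
    show "W \<in> vague_uniformity X" if W: "V \<subseteq> W \<and> W \<subseteq> X \<times> X" for W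
      unfolding vague_uniformity_def using V W
      by (intro CollectI conjI exI[of _ \<Phi>] exI[of _ \<epsilon>]) auto
    show "V \<inter> W \<in> vague_uniformity X" if "W \<in> vague_uniformity X" for W
    proof -
      obtain \<Psi> \<delta> where W: "finite \<Psi>" "\<Psi> \<subseteq> Cc" "\<delta> > 0" "vague_entourage X \<Psi> \<delta> \<subseteq> W" "W \<subseteq> X \<times> X"
        using \<open>W \<in> vague_uniformity X\<close> by (rule vague_uniformityE)
      have "vague_entourage X (\<Phi> \<union> \<Psi>) (min \<epsilon> \<delta>) \<subseteq> vague_entourage X \<Phi> \<epsilon> \<inter> vague_entourage X \<Psi> \<delta>"
        by (auto simp: vague_entourage_def vague_ball_def)
      then show ?thesis
        unfolding vague_uniformity_def using V W
        by (intro CollectI conjI exI[of _ "\<Phi> \<union> \<Psi>"] exI[of _ "min \<epsilon> \<delta>"]) auto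
    qed
    have "vague_entourage X \<Phi> \<epsilon> \<subseteq> (vague_entourage X \<Phi> \<epsilon>)\<inverse>"
      using X by (auto simp: vague_entourage_def vague_ball_def norm_minus_commute)
    then have "vague_entourage X \<Phi> \<epsilon> \<subseteq> V\<inverse>" using V(4) by blast
    then show "V\<inverse> \<in> vague_uniformity X"
      unfolding vague_uniformity_def using V
      by (intro CollectI conjI exI[of _ \<Phi>] exI[of _ \<epsilon>]) auto
    have "vague_entourage X \<Phi> (\<epsilon> / 2) O vague_entourage X \<Phi> (\<epsilon> / 2) \<subseteq> vague_entourage X \<Phi> \<epsilon>"
    proof (clarsimp simp: vague_entourage_def vague_ball_def)
      fix \<mu> \<nu> \<rho> \<phi>
      assume "\<phi> \<in> \<Phi>"
        and "\<forall>\<phi>\<in>\<Phi>. cmod (complex_integral \<nu> \<phi> - complex_integral \<mu> \<phi>) * 2 < \<epsilon>"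
        and "\<forall>\<phi>\<in>\<Phi>. cmod (complex_integral \<rho> \<phi> - complex_integral \<nu> \<phi>) * 2 < \<epsilon>"
      then have "cmod (complex_integral \<nu> \<phi> - complex_integral \<mu> \<phi>) * 2 < \<epsilon>"
        "cmod (complex_integral \<rho> \<phi> - complex_integral \<nu> \<phi>) * 2 < \<epsilon>" by auto
      then show "cmod (complex_integral \<rho> \<phi> - complex_integral \<mu> \<phi>) < \<epsilon>"
        using norm_triangle_ineq[of "complex_integral \<rho> \<phi> - complex_integral \<nu> \<phi>"
            "complex_integral \<nu> \<phi> - complex_integral \<mu> \<phi>"] by simp
    qed
    then have "vague_entourage X \<Phi> (\<epsilon> / 2) O vague_entourage X \<Phi> (\<epsilon> / 2) \<subseteq> V"
      using V(4) by (rule order_trans)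
    then show "\<exists>W\<in>vague_uniformity X. W O W \<subseteq> V"
      using V(1-3) by (intro bexI[OF _ vague_entourage_in_uniformity[of \<Phi> "\<epsilon> / 2"]]) auto
  qed
  moreover have "openin (subtopology vague_topology X) S \<longleftrightarrow>
      S \<subseteq> X \<and> (\<forall>\<nu>\<in>S. \<exists>V\<in>vague_uniformity X. V `` {\<nu>} \<subseteq> S)" for S
  proof (intro iffI conjI ballI)
    assume S: "openin (subtopology vague_topology X) S"
    then obtain T where T: "openin vague_topology T" "S = T \<inter> X" by (auto simp: openin_subtopology)
    then show "S \<subseteq> X" by simp
    fix \<nu> assume \<nu>: "\<nu> \<in> S"
    then obtain \<Phi> \<epsilon> where "finite \<Phi>" "\<Phi> \<subseteq> Cc" "\<epsilon> > 0" "vague_ball \<nu> \<Phi> \<epsilon> \<subseteq> T"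
      using T unfolding openin_vague_iff by blast
    then show "\<exists>V\<in>vague_uniformity X. V `` {\<nu>} \<subseteq> S"
      using T(2) \<nu> slice[of \<nu> \<Phi> \<epsilon>] by (intro bexI[OF _ vague_entourage_in_uniformity]) auto
  next
    assume S: "S \<subseteq> X \<and> (\<forall>\<nu>\<in>S. \<exists>V\<in>vague_uniformity X. V `` {\<nu>} \<subseteq> S)"
    show "openin (subtopology vague_topology X) S"
    proof (subst openin_subopen, intro ballI)
      fix \<nu> assume \<nu>: "\<nu> \<in> S"
      then obtain V where V: "V \<in> vague_uniformity X" "V `` {\<nu>} \<subseteq> S" using S by blast
      obtain \<Phi> \<epsilon> where *: "finite \<Phi>" "\<Phi> \<subseteq> Cc" "\<epsilon> > 0" "vague_entourage X \<Phi> \<epsilon> \<subseteq> V"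
        using V(1) by (rule vague_uniformityE)
      have "\<nu> \<in> X" using \<nu> S by blast
      then have "X \<inter> vague_ball \<nu> \<Phi> \<epsilon> \<subseteq> S" "\<nu> \<in> vague_ball \<nu> \<Phi> \<epsilon>"
        using slice[OF \<open>\<nu> \<in> X\<close>, of \<Phi> \<epsilon>] *(3,4) V(2) X vague_ball_centre by blast+
      then show "\<exists>T. openin (subtopology vague_topology X) T \<and> \<nu> \<in> T \<and> T \<subseteq> S"
        using openin_vague_ball[OF *(1,2)] \<open>\<nu> \<in> X\<close>
        by (intro exI[of _ "vague_ball \<nu> \<Phi> \<epsilon> \<inter> X"]) (auto simp: openin_subtopology)
    qed
  qed
  ultimately show ?thesis unfolding compatible_uniformity_def top by blast
qed

section \<open>The Fell topology\<close>

text \<open>The points are all subsets, not only the closed ones, so the topology need not be Hausdorff; it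
  serves as a compact parameter space for the measures \<open>\<delta>\<^sub>M\<close>.\<close>

definition fell_subbase :: "'a::topological_space set set set" where
  "fell_subbase = {{F. F \<inter> K = {}} |K. compact K} \<union> {{F. F \<inter> U \<noteq> {}} |U. open U}"

definition fell_topology :: "'a::topological_space set topology" where
  "fell_topology =
     topology (arbitrary union_of (finite intersection_of (\<lambda>S. S \<in> fell_subbase) relative_to UNIV))"

lemma topspace_fell [simp]: "topspace fell_topology = UNIV"
  unfolding fell_topology_def by simp

lemma openin_fell_subbase: "S \<in> fell_subbase \<Longrightarrow> openin fell_topology S"
  unfolding fell_topology_def openin_subbase
  by (simp add: arbitrary_union_of_inc finite_intersection_of_inc relative_to_subset_inc)

lemma openin_fell_miss: "compact K \<Longrightarrow> openin fell_topology {F. F \<inter> K = {}}"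
  by (rule openin_fell_subbase) (auto simp: fell_subbase_def)

lemma openin_fell_hit: "open U \<Longrightarrow> openin fell_topology {F. F \<inter> U \<noteq> {}}"
  by (rule openin_fell_subbase) (auto simp: fell_subbase_def)

text \<open>Alexander's subbase theorem.  Given a cover by subbasic sets, let \<open>F\<close> be the largest set that avoids
  all the open sets \<open>U\<close> occurring in hitting conditions of the cover.  It satisfies some condition of the cover, which must
  be \<open>F \<inter> K = {}\<close>; so these open sets cover \<open>K\<close>, and finitely many of them do.\<close>

lemma compact_fell: "compact_space (fell_topology :: 'a::topological_space set topology)"
proof (rule Alexander_subbase_alt[OF _ _ fell_topology_def[symmetric]])
  have "{F::'a set. F \<inter> {} = {}} \<in> fell_subbase"
    unfolding fell_subbase_def by (intro UnI1 CollectI exI[of _ "{}"]) simp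
  then show "UNIV \<subseteq> \<Union>(fell_subbase :: 'a set set set)" by auto
next
  fix C :: "'a set set set" assume C: "C \<subseteq> fell_subbase" "UNIV \<subseteq> \<Union>C"
  define \<U> where "\<U> = {U::'a set. open U \<and> {F. F \<inter> U \<noteq> {}} \<in> C}"
  obtain S where S: "S \<in> C" "- \<Union>\<U> \<in> S" using C(2) by blast
  have "False" if "S = {F. F \<inter> U \<noteq> {}}" "open U" for U
  proof -
    have "U \<in> \<U>" using that S(1) by (simp add: \<U>_def)
    then have "- \<Union>\<U> \<inter> U = {}" by auto
    then show False using S(2) that(1) by simp
  qed
  moreover have "S \<in> fell_subbase" using S(1) C(1) by auto
  ultimately obtain K where K: "S = {F. F \<inter> K = {}}" "compact K"
    unfolding fell_subbase_def by auto
  have "K \<subseteq> \<Union>\<U>" using S(2) K(1) by auto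
  moreover have "\<And>U. U \<in> \<U> \<Longrightarrow> open U" by (simp add: \<U>_def)
  ultimately obtain D where D: "D \<subseteq> \<U>" "finite D" "K \<subseteq> \<Union>D"
    using compactE[OF K(2)] by metis
  show "\<exists>C'. finite C' \<and> C' \<subseteq> C \<and> UNIV \<subseteq> \<Union>C'"
  proof (intro exI conjI)
    show "finite (insert S ((\<lambda>U. {F. F \<inter> U \<noteq> {}}) ` D))" using D(2) by simp
    show "insert S ((\<lambda>U. {F. F \<inter> U \<noteq> {}}) ` D) \<subseteq> C" using D(1) S(1) by (auto simp: \<U>_def)
    show "UNIV \<subseteq> \<Union>(insert S ((\<lambda>U. {F. F \<inter> U \<noteq> {}}) ` D))"
    proof
      fix F :: "'a set"
      show "F \<in> \<Union>(insert S ((\<lambda>U. {F. F \<inter> U \<noteq> {}}) ` D))"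
      proof (cases "F \<inter> K = {}")
        case False
        then obtain x U where "x \<in> F" "U \<in> D" "x \<in> U" using D(3) by blast
        then show ?thesis by auto
      qed (simp add: K(1))
    qed
  qed
qed

section \<open>Separated sets\<close>

text \<open>Uniform discreteness with the neighbourhood \<open>V\<close> kept fixed: limits of translates of \<open>L\<close> are
  separated by the same \<open>V\<close>, while a mere existence statement about \<open>V\<close> would not define a closed set.\<close>

definition separated_by :: "'g::ab_group_add set \<Rightarrow> 'g set \<Rightarrow> bool" where
  "separated_by V M \<longleftrightarrow> (\<forall>x\<in>M. \<forall>y\<in>M. x - y \<in> V \<longrightarrow> x = y)"

lemma separated_by_translate: "separated_by V M \<Longrightarrow> separated_by V ((+) t ` M)"
  by (auto simp: separated_by_def)

lemma uniformly_discrete_separated: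
  assumes "uniformly_discrete L"
  obtains V where "open V" "0 \<in> V" "separated_by V L"
proof -
  obtain U where U: "open U" "0 \<in> U" "\<And>x y. x \<in> L \<Longrightarrow> y \<in> L \<Longrightarrow> x \<noteq> y \<Longrightarrow> (+) x ` U \<inter> (+) y ` U = {}"
    using assms unfolding uniformly_discrete_def by metis
  have "x = y" if "x \<in> L" "y \<in> L" "x - y \<in> U" for x y
  proof (rule ccontr)
    assume "x \<noteq> y"
    have "x \<in> (+) x ` U" using U(2) by force
    moreover have "x \<in> (+) y ` U" using that(3) by (intro image_eqI[of _ _ "x - y"]) auto
    ultimately show False using U(3)[OF that(1,2) \<open>x \<noteq> y\<close>] by blast
  qed
  then show thesis using that U by (simp add: separated_by_def)
qed

lemma open_diff_neighbourhoods:
  fixes V :: "'g::topological_ab_group_add set"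
  assumes "open V" "x - y \<in> V"
  obtains A B where "open A" "open B" "x \<in> A" "y \<in> B" "\<And>a b. a \<in> A \<Longrightarrow> b \<in> B \<Longrightarrow> a - b \<in> V"
proof -
  have "open ((\<lambda>p. fst p - snd p) -` V)"
    by (intro open_vimage assms continuous_intros)
  moreover have "(x, y) \<in> (\<lambda>p. fst p - snd p) -` V" using assms by simp
  ultimately obtain A B where AB: "open A" "open B" "(x, y) \<in> A \<times> B" "A \<times> B \<subseteq> (\<lambda>p. fst p - snd p) -` V"
    by (rule open_prod_elim)
  have "a - b \<in> V" if "a \<in> A" "b \<in> B" for a b
  proof -
    have "(a, b) \<in> (\<lambda>p. fst p - snd p) -` V" using AB(4) that by blast
    then show ?thesis by simp
  qed
  with AB(1-3) that show thesis by blast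
qed

lemma open_half_neighbourhood:
  fixes V :: "'g::topological_ab_group_add set"
  assumes "open V" "0 \<in> V"
  obtains W where "open W" "0 \<in> W" "\<And>a b. a \<in> W \<Longrightarrow> b \<in> W \<Longrightarrow> a - b \<in> V"
proof -
  have "(0::'g) - 0 \<in> V" using assms by simp
  then obtain A B where AB: "open A" "open B" "0 \<in> A" "0 \<in> B" "\<And>a b. a \<in> A \<Longrightarrow> b \<in> B \<Longrightarrow> a - b \<in> V"
    using open_diff_neighbourhoods[OF assms(1)] by metis
  then show thesis using that[of "A \<inter> B"] by auto
qed

lemma open_translate:
  fixes W :: "'g::topological_ab_group_add set"
  assumes "open W"
  shows "open {a. a - x \<in> W}"
proof -
  have "open ((\<lambda>a. a - x) -` W)" by (intro open_vimage assms continuous_intros)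
  then show ?thesis by (simp add: vimage_def)
qed

lemma separated_by_locally_finite:
  fixes M :: "'g::topological_ab_group_add set"
  assumes V: "open V" "0 \<in> V" and M: "separated_by V M"
  shows "locally_finite M"
  unfolding locally_finite_def
proof (intro allI impI)
  fix C :: "'g set" assume C: "compact C"
  obtain W where W: "open W" "0 \<in> W" "\<And>a b. a \<in> W \<Longrightarrow> b \<in> W \<Longrightarrow> a - b \<in> V"
    using open_half_neighbourhood[OF V] by metis
  define N where "N x = {a. a - x \<in> W}" for x
  obtain D where D: "finite D" "C \<subseteq> (\<Union>x\<in>D. N x)"
  proof (rule compactE_image[OF C, of C N])
    show "open (N x)" for x unfolding N_def by (rule open_translate[OF W(1)])
    show "C \<subseteq> (\<Union>x\<in>C. N x)" using W(2) by (auto simp: N_def)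
  qed (use that in blast)
  have "finite (M \<inter> N x)" for x
  proof -
    have eq: "a = b" if "a \<in> M \<inter> N x" "b \<in> M \<inter> N x" for a b
      using M W(3)[of "a - x" "b - x"] that by (auto simp: separated_by_def N_def)
    show ?thesis
    proof (cases "M \<inter> N x = {}")
      case False
      then obtain a where "a \<in> M \<inter> N x" by blast
      with eq have "M \<inter> N x \<subseteq> {a}" by blast
      then show ?thesis by (rule finite_subset) simp
    qed simp
  qed
  then have "finite (\<Union>x\<in>D. M \<inter> N x)" using D(1) by blast
  then show "finite (M \<inter> C)" by (rule finite_subset[rotated]) (use D(2) in blast)
qed

text \<open>If \<open>M\<close> contains two different points with difference in \<open>V\<close>, then so does every set that hits small
  disjoint neighbourhoods of these two points.\<close>

lemma closedin_fell_separated: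
  fixes V :: "'g::{topological_ab_group_add, t2_space} set"
  assumes V: "open V"
  shows "closedin fell_topology {M. separated_by V M}"
proof -
  have "openin fell_topology {M. \<not> separated_by V M}"
  proof (subst openin_subopen, intro ballI)
    fix M assume "M \<in> {M. \<not> separated_by V M}"
    then obtain x y where xy: "x \<in> M" "y \<in> M" "x - y \<in> V" "x \<noteq> y" by (auto simp: separated_by_def)
    obtain A B where AB: "open A" "open B" "x \<in> A" "y \<in> B" "\<And>a b. a \<in> A \<Longrightarrow> b \<in> B \<Longrightarrow> a - b \<in> V"
      using open_diff_neighbourhoods[OF V xy(3)] by metis
    obtain P Q where PQ: "open P" "open Q" "x \<in> P" "y \<in> Q" "P \<inter> Q = {}"
      using hausdorff[OF xy(4)] by blast
    let ?T = "{F. F \<inter> (A \<inter> P) \<noteq> {}} \<inter> {F. F \<inter> (B \<inter> Q) \<noteq> {}}"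
    have "openin fell_topology ?T"
      using AB PQ by (intro openin_Int openin_fell_hit open_Int)
    moreover have "M \<in> ?T" using xy AB PQ by blast
    moreover have "?T \<subseteq> {M. \<not> separated_by V M}"
    proof
      fix F assume "F \<in> ?T"
      then obtain a b where ab: "a \<in> F" "a \<in> A" "a \<in> P" "b \<in> F" "b \<in> B" "b \<in> Q" by blast
      then have "a \<noteq> b" using PQ(5) by blast
      with ab AB(5)[of a b] show "F \<in> {M. \<not> separated_by V M}" unfolding separated_by_def by blast
    qed
    ultimately show "\<exists>T. openin fell_topology T \<and> M \<in> T \<and> T \<subseteq> {M. \<not> separated_by V M}" by blast
  qed
  moreover have "UNIV - {M. separated_by V M} = {M. \<not> separated_by V M}" by auto
  ultimately show ?thesis by (simp add: closedin_def)
qed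

text \<open>If \<open>M\<close> is close to the separated set \<open>M'\<close>, then over a compact set each point of \<open>M\<close> has exactly
  one companion in \<open>M'\<close>: at least one by a hitting condition, at most one by separation.\<close>

lemma continuous_map_fell_integral:
  fixes V :: "'g::{topological_ab_group_add, t2_space} set"
  assumes lc: "locally_compact_space (euclidean :: 'g topology)"
    and V: "open V" "0 \<in> V" and \<phi>: "\<phi> \<in> Cc"
  shows "continuous_map (subtopology fell_topology {M. separated_by V M}) euclidean
     (\<lambda>M. complex_integral (delta M) \<phi>)"
proof -
  obtain C where C: "compact C" "\<And>x. x \<notin> C \<Longrightarrow> \<phi> x = 0" using Cc_support[OF \<phi>] by metis
  have lf: "locally_finite M" if "separated_by V M" for M
    by (rule separated_by_locally_finite[OF V that])
  have int: "complex_integral (delta M) \<phi> = (\<Sum>x\<in>M \<inter> C. \<phi> x)" if "separated_by V M" for M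
    by (rule complex_integral_delta_compact[OF lc lf[OF that] \<phi> C])
  obtain W where W: "open W" "0 \<in> W" "\<And>a b. a \<in> W \<Longrightarrow> b \<in> W \<Longrightarrow> a - b \<in> V"
    using open_half_neighbourhood[OF V] by metis
  have nbhd: "\<exists>T. openin fell_topology T \<and> M \<in> T \<and>
      (\<forall>M'\<in>T. separated_by V M' \<longrightarrow> cmod (complex_integral (delta M') \<phi> - complex_integral (delta M) \<phi>) < \<epsilon>)"
    if M: "separated_by V M" and "\<epsilon> > 0" for M \<epsilon>
  proof -
    define S where "S = M \<inter> C"
    have S: "finite S" using lf[OF M] C(1) by (simp add: S_def locally_finite_def)
    \<comment> \<open>The sum over \<open>S\<close> of the errors \<open>\<delta>\<close> must stay below \<open>\<epsilon>\<close>, also for empty \<open>S\<close>.\<close>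
    define \<delta> where "\<delta> = \<epsilon> / (real (card S) + 1)"
    have \<delta>: "\<delta> > 0" "real (card S) * \<delta> < \<epsilon>"
      using \<open>\<epsilon> > 0\<close> by (auto simp: \<delta>_def field_simps)
    define U where "U x = {a. a - x \<in> W} \<inter> \<phi> -` ball (\<phi> x) \<delta>" for x
    have U: "open (U x)" "x \<in> U x" for x
      unfolding U_def using W(2) \<delta>(1) Cc_continuous[OF \<phi>]
      by (auto intro!: open_Int open_translate W(1) open_vimage)
    define K where "K = C - (\<Union>x\<in>S. U x)"
    have K: "compact K" unfolding K_def using C(1) U(1) by (intro compact_diff) auto
    define T where "T = {F. F \<inter> K = {}} \<inter> ((\<Inter>x\<in>S. {F. F \<inter> U x \<noteq> {}}) \<inter> topspace fell_topology)"
    have "openin fell_topology T"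
      unfolding T_def by (intro openin_Int openin_fell_miss K openin_INT S openin_fell_hit U(1))
    moreover have "M \<in> T" unfolding T_def using U(2) by (auto simp: K_def S_def)
    moreover have "cmod (complex_integral (delta M') \<phi> - complex_integral (delta M) \<phi>) < \<epsilon>"
      if M': "M' \<in> T" "separated_by V M'" for M'
    proof -
      have "\<forall>x\<in>S. \<exists>y. y \<in> M' \<inter> U x" using M'(1) by (auto simp: T_def)
      then obtain y where y: "\<And>x. x \<in> S \<Longrightarrow> y x \<in> M' \<inter> U x" by metis
      have y_unique: "z = y x" if "x \<in> S" "z \<in> M'" "z \<in> U x" for x z
        using M'(2) y[OF that(1)] that W(3)[of "z - x" "y x - x"]
        by (auto simp: separated_by_def U_def)
      have inj: "inj_on y S"
      proof (rule inj_onI)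
        fix x x' assume xx: "x \<in> S" "x' \<in> S" "y x = y x'"
        \<comment> \<open>The difference below is \<open>x - x'\<close>.\<close>
        then have "(y x - x') - (y x - x) \<in> V"
          using y[of x] y[of x'] by (intro W(3)) (auto simp: U_def)
        then show "x = x'" using M xx by (auto simp: separated_by_def S_def)
      qed
      have near: "z \<in> y ` S" if z: "z \<in> M' \<inter> C" for z
      proof -
        obtain x where "x \<in> S" "z \<in> U x" using z M'(1) by (auto simp: T_def K_def)
        then show ?thesis using y_unique[of x z] z by auto
      qed
      have "complex_integral (delta M') \<phi> = (\<Sum>z\<in>y ` S. \<phi> z)"
        unfolding int[OF M'(2)] using near S y C(2) by (intro sum.mono_neutral_left) auto
      also have "\<dots> = (\<Sum>x\<in>S. \<phi> (y x))" by (simp add: sum.reindex[OF inj])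
      finally have "complex_integral (delta M') \<phi> - complex_integral (delta M) \<phi> = (\<Sum>x\<in>S. \<phi> (y x) - \<phi> x)"
        by (simp add: int[OF M] S_def sum_subtractf)
      also have "cmod \<dots> \<le> (\<Sum>x\<in>S. \<delta>)"
        using y by (intro sum_norm_le) (force simp: U_def dist_norm norm_minus_commute)
      also have "\<dots> < \<epsilon>" using \<delta>(2) by simp
      finally show ?thesis .
    qed
    ultimately show ?thesis by blast
  qed
  show ?thesis
    unfolding continuous_map_def
  proof (intro conjI allI impI)
    fix O' :: "complex set" assume "openin euclidean O'"
    then have O': "open O'" by simp
    show "openin (subtopology fell_topology {M. separated_by V M})
        {M \<in> topspace (subtopology fell_topology {M. separated_by V M}). complex_integral (delta M) \<phi> \<in> O'}"
    proof (subst openin_subopen, intro ballI)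
      fix M assume "M \<in> {M \<in> topspace (subtopology fell_topology {M. separated_by V M}). complex_integral (delta M) \<phi> \<in> O'}"
      then have M: "separated_by V M" "complex_integral (delta M) \<phi> \<in> O'" by auto
      obtain \<epsilon> where \<epsilon>: "\<epsilon> > 0" "ball (complex_integral (delta M) \<phi>) \<epsilon> \<subseteq> O'"
        using O' M(2) by (auto simp: open_contains_ball)
      obtain T where T: "openin fell_topology T" "M \<in> T" "\<And>M'. M' \<in> T \<Longrightarrow> separated_by V M' \<Longrightarrow>
          cmod (complex_integral (delta M') \<phi> - complex_integral (delta M) \<phi>) < \<epsilon>"
        using nbhd[OF M(1) \<epsilon>(1)] by blast
      have "T \<inter> {M. separated_by V M} \<subseteq>
          {M \<in> topspace (subtopology fell_topology {M. separated_by V M}). complex_integral (delta M) \<phi> \<in> O'}"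
        using T(3) \<epsilon>(2) by (auto simp: subset_eq dist_norm norm_minus_commute)
      then show "\<exists>Ta. openin (subtopology fell_topology {M. separated_by V M}) Ta \<and> M \<in> Ta \<and> Ta \<subseteq>
          {M \<in> topspace (subtopology fell_topology {M. separated_by V M}). complex_integral (delta M) \<phi> \<in> O'}"
        using T M by (intro exI[of _ "T \<inter> {M. separated_by V M}"]) (auto simp: openin_subtopology)
    qed
  qed auto
qed

lemma compactin_vague_separated:
  fixes V :: "'g::{topological_ab_group_add, t2_space} set"
  assumes lc: "locally_compact_space (euclidean :: 'g topology)" and V: "open V" "0 \<in> V"
  shows "compactin vague_topology (delta ` {M. separated_by V M})"
proof -
  let ?S = "{M. separated_by V M}"
  have "compactin fell_topology ?S"
    using closedin_compact_space[OF compact_fell closedin_fell_separated[OF V(1)]] .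
  then have "compactin (subtopology fell_topology ?S) ?S"
    by (simp add: compactin_subtopology)
  moreover have "continuous_map (subtopology fell_topology ?S) vague_topology delta"
    using continuous_map_fell_integral[OF lc V]
    by (intro continuous_map_into_vague)
      (auto intro: delta_complex_measure[OF lc] separated_by_locally_finite[OF V])
  ultimately show ?thesis by (rule image_compactin)
qed


section \<open>Uniformities and extension by continuity\<close>

lemma closure_of_meets:
  assumes "x \<in> X closure_of S" "openin X T" "x \<in> T"
  obtains y where "y \<in> S" "y \<in> T"
  using assms unfolding in_closure_of by metis

text \<open>The definition of compatibility only says which sets are open; that \<open>V[z]\<close> is a neighbourhood of
  \<open>z\<close> uses the halving axiom, as in every passage from a uniformity to its topology.\<close>

lemma compatible_uniformity_interior:
  assumes comp: "compatible_uniformity T \<U>" and V: "V \<in> \<U>" and z: "z \<in> topspace T"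
  obtains N where "openin T N" "z \<in> N" "N \<subseteq> V `` {z}"
proof
  let ?N = "{y \<in> topspace T. \<exists>W\<in>\<U>. W `` {y} \<subseteq> V `` {z}}"
  have unif: "uniform_structure_on (topspace T) \<U>"
    and op: "\<And>S. openin T S \<longleftrightarrow> S \<subseteq> topspace T \<and> (\<forall>x\<in>S. \<exists>V\<in>\<U>. V `` {x} \<subseteq> S)"
    using comp by (auto simp: compatible_uniformity_def)
  show "openin T ?N"
    unfolding op
  proof (intro conjI ballI)
    fix y assume "y \<in> ?N"
    then obtain W where W: "W \<in> \<U>" "W `` {y} \<subseteq> V `` {z}" by blast
    then obtain W' where W': "W' \<in> \<U>" "W' O W' \<subseteq> W"
      using unif unfolding uniform_structure_on_def by meson
    have "W' \<subseteq> topspace T \<times> topspace T"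
      using unif W'(1) unfolding uniform_structure_on_def by meson
    then have "W' `` {y} \<subseteq> ?N" using W W' by blast
    then show "\<exists>V\<in>\<U>. V `` {y} \<subseteq> ?N" using W'(1) by blast
  qed auto
  show "z \<in> ?N" using z V by auto
  show "?N \<subseteq> V `` {z}"
  proof
    fix y assume "y \<in> ?N"
    then obtain W where W: "y \<in> topspace T" "W \<in> \<U>" "W `` {y} \<subseteq> V `` {z}" by blast
    have "Id_on (topspace T) \<subseteq> W"
      using unif W(2) unfolding uniform_structure_on_def by meson
    then show "y \<in> V `` {z}" using W by blast
  qed
qed

lemma uniform_structure_symmetric_half:
  assumes unif: "uniform_structure_on X \<U>" and V: "V \<in> \<U>"
  obtains E where "E \<in> \<U>" "E\<inverse> = E" "E O E \<subseteq> V" "Id_on X \<subseteq> E" "E \<subseteq> X \<times> X"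
proof -
  obtain W where W: "W \<in> \<U>" "W O W \<subseteq> V"
    using unif V unfolding uniform_structure_on_def by meson
  have "W\<inverse> \<in> \<U>" using unif W(1) unfolding uniform_structure_on_def by meson
  then have E: "W \<inter> W\<inverse> \<in> \<U>" using unif W(1) unfolding uniform_structure_on_def by meson
  then have "Id_on X \<subseteq> W \<inter> W\<inverse>" "W \<inter> W\<inverse> \<subseteq> X \<times> X"
    using unif unfolding uniform_structure_on_def by meson+
  then show thesis using that[OF E] W(2) by blast
qed

text \<open>The extension is the closure of the graph of \<open>k i \<mapsto> m i\<close>: its fibres are nonempty because
  projections along the compact space \<open>Z\<close> are closed maps, and they are single points by the Cauchy
  condition.\<close>

lemma extend_from_dense:
  fixes k :: "'i \<Rightarrow> 'a" and m :: "'i \<Rightarrow> 'b"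
  assumes Z: "compact_space Z" "Hausdorff_space Z" and comp: "compatible_uniformity Z \<U>"
    and k: "\<And>i. k i \<in> topspace Y" "Y closure_of range k = topspace Y"
    and m: "\<And>i. m i \<in> topspace Z"
    and cauchy: "\<And>y V. y \<in> topspace Y \<Longrightarrow> V \<in> \<U> \<Longrightarrow>
      \<exists>P. openin Y P \<and> y \<in> P \<and> (\<forall>i i'. k i \<in> P \<longrightarrow> k i' \<in> P \<longrightarrow> (m i, m i') \<in> V)"
  obtains g where "continuous_map Y Z g" "\<And>i. g (k i) = m i"
proof -
  let ?YZ = "prod_topology Y Z"
  define \<Gamma> where "\<Gamma> = ?YZ closure_of range (\<lambda>i. (k i, m i))"
  have unif: "uniform_structure_on (topspace Z) \<U>"
    and op: "\<And>S. openin Z S \<longleftrightarrow> S \<subseteq> topspace Z \<and> (\<forall>x\<in>S. \<exists>V\<in>\<U>. V `` {x} \<subseteq> S)"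
    using comp by (auto simp: compatible_uniformity_def)
  have \<Gamma>_closed: "closedin ?YZ \<Gamma>" unfolding \<Gamma>_def by simp
  have \<Gamma>_sub: "\<Gamma> \<subseteq> topspace Y \<times> topspace Z"
    using closedin_subset[OF \<Gamma>_closed] by simp
  have graph: "(k i, m i) \<in> \<Gamma>" for i
  proof -
    have "range (\<lambda>i. (k i, m i)) \<subseteq> \<Gamma>"
      unfolding \<Gamma>_def using k(1) m by (intro closure_of_subset) auto
    then show ?thesis by auto
  qed
  have proj: "closedin Y (fst ` D)" if "closedin ?YZ D" for D
    using closed_map_fst[OF Z(1), of Y] that by (auto simp: closed_map_def)
  have "range k \<subseteq> fst ` \<Gamma>"
  proof (rule image_subsetI)
    fix i show "k i \<in> fst ` \<Gamma>" using graph[of i] by (intro image_eqI[of _ _ "(k i, m i)"]) auto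
  qed
  then have total: "topspace Y \<subseteq> fst ` \<Gamma>"
    using closure_of_minimal[OF _ proj[OF \<Gamma>_closed]] k(2) by metis
  have near: "\<exists>i. k i \<in> P \<and> m i \<in> N"
    if "(y, z) \<in> \<Gamma>" "openin Y P" "y \<in> P" "openin Z N" "z \<in> N" for y z P N
  proof -
    have op: "openin ?YZ (P \<times> N)" using that by (simp add: openin_prod_Times_iff)
    have mem: "(y, z) \<in> P \<times> N" using that by simp
    obtain p where "p \<in> range (\<lambda>i. (k i, m i))" "p \<in> P \<times> N"
      by (rule closure_of_meets[OF \<open>(y, z) \<in> \<Gamma>\<close>[unfolded \<Gamma>_def] op mem])
    then show ?thesis by auto
  qed
  have unique: "z = z'" if yz: "(y, z) \<in> \<Gamma>" "(y, z') \<in> \<Gamma>" for y z z'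
  proof (rule ccontr)
    assume ne: "z \<noteq> z'"
    have top: "y \<in> topspace Y" "z \<in> topspace Z" "z' \<in> topspace Z" using yz \<Gamma>_sub by auto
    obtain S S' where S: "openin Z S" "openin Z S'" "z \<in> S" "z' \<in> S'" "disjnt S S'"
      using Z(2) top(2,3) ne unfolding Hausdorff_space_def by metis
    obtain V where V: "V \<in> \<U>" "V `` {z} \<subseteq> S" using S(1,3) op by metis
    have zz': "(z, z') \<notin> V" using V(2) S(4,5) by (auto simp: disjnt_def)
    obtain E1 where E1: "E1 \<in> \<U>" "E1 O E1 \<subseteq> V"
      using uniform_structure_symmetric_half[OF unif V(1)] by metis
    obtain E where E: "E \<in> \<U>" "E\<inverse> = E" "E O E \<subseteq> E1" "Id_on (topspace Z) \<subseteq> E" "E \<subseteq> topspace Z \<times> topspace Z"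
      using uniform_structure_symmetric_half[OF unif E1(1)] by metis
    obtain P where P: "openin Y P" "y \<in> P" "\<And>i i'. k i \<in> P \<Longrightarrow> k i' \<in> P \<Longrightarrow> (m i, m i') \<in> E"
      using cauchy[OF top(1) E(1)] by metis
    obtain N where N: "openin Z N" "z \<in> N" "N \<subseteq> E `` {z}"
      using compatible_uniformity_interior[OF comp E(1) top(2)] by metis
    obtain N' where N': "openin Z N'" "z' \<in> N'" "N' \<subseteq> E `` {z'}"
      using compatible_uniformity_interior[OF comp E(1) top(3)] by metis
    obtain i where i: "k i \<in> P" "m i \<in> N" using near[OF yz(1) P(1,2) N(1,2)] by metis
    obtain i' where i': "k i' \<in> P" "m i' \<in> N'" using near[OF yz(2) P(1,2) N'(1,2)] by metis
    have a: "(z, m i) \<in> E" "(m i, m i') \<in> E" "(z', m i') \<in> E"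
      using i i' N(3) N'(3) P(3)[OF i(1) i'(1)] by auto
    \<comment> \<open>The chain \<open>z, m i, m i', z'\<close> has three steps in \<open>E\<close>.\<close>
    have b: "(m i', z') \<in> E" using a(3) E(2) by blast
    have "(z, m i') \<in> E1" using a(1,2) E(3) by blast
    moreover have "(z', z') \<in> E" using E(4) top(3) by blast
    then have "(m i', z') \<in> E1" using b E(3) by blast
    ultimately have "(z, z') \<in> V" using E1(2) by blast
    with zz' show False by simp
  qed
  define g where "g y = (SOME z. (y, z) \<in> \<Gamma>)" for y
  have g_graph: "(y, g y) \<in> \<Gamma>" if "y \<in> topspace Y" for y
  proof -
    have "\<exists>z. (y, z) \<in> \<Gamma>" using total that by force
    then show ?thesis unfolding g_def by (rule someI_ex)
  qed
  have "continuous_map Y Z g"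
    unfolding continuous_map_closedin
  proof (intro conjI allI impI)
    show "g \<in> topspace Y \<rightarrow> topspace Z" using g_graph \<Gamma>_sub by auto
    fix C assume C: "closedin Z C"
    have "closedin ?YZ (topspace Y \<times> C)" using C by (simp add: closedin_prod_Times_iff)
    then have "closedin Y (fst ` (\<Gamma> \<inter> (topspace Y \<times> C)))"
      using \<Gamma>_closed by (intro proj closedin_Int)
    moreover have "fst ` (\<Gamma> \<inter> (topspace Y \<times> C)) = {y \<in> topspace Y. g y \<in> C}"
    proof (intro equalityI subsetI)
      fix y assume "y \<in> fst ` (\<Gamma> \<inter> (topspace Y \<times> C))"
      then obtain z where z: "(y, z) \<in> \<Gamma>" "y \<in> topspace Y" "z \<in> C" by auto
      with unique[OF g_graph[OF z(2)] z(1)] show "y \<in> {y \<in> topspace Y. g y \<in> C}" by simp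
    next
      fix y assume "y \<in> {y \<in> topspace Y. g y \<in> C}"
      then show "y \<in> fst ` (\<Gamma> \<inter> (topspace Y \<times> C))"
        using g_graph[of y] by (intro image_eqI[of _ _ "(y, g y)"]) auto
    qed
    ultimately show "closedin Y {y \<in> topspace Y. g y \<in> C}" by simp
  qed
  moreover have "g (k i) = m i" for i
    using unique[OF g_graph[OF k(1)] graph] .
  ultimately show thesis by (rule that)
qed

section \<open>Group compactifications\<close>

text \<open>Here \<open>j\<close> stands for the orbit map \<open>t \<mapsto> t + L\<close>.  Addition and inversion are uniformly
  continuous along the orbit: \<open>j (s + t)\<close> moves little when \<open>j s\<close> does, uniformly in \<open>t\<close>, and
  \<open>j (- s)\<close> and \<open>j (- s')\<close> are the translates of \<open>j s'\<close> and \<open>j s\<close> by \<open>- s - s'\<close>.\<close>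

lemma group_from_equicontinuous_orbit:
  fixes j :: "'g::ab_group_add \<Rightarrow> 'a"
  assumes X: "compact_space X" "Hausdorff_space X" and comp: "compatible_uniformity X \<U>"
    and j: "\<And>t. j t \<in> topspace X" "X closure_of range j = topspace X"
    and equi: "\<And>V. V \<in> \<U> \<Longrightarrow> \<exists>U\<in>\<U>. \<forall>s s'. (j s, j s') \<in> U \<longrightarrow> (\<forall>t. (j (t + s), j (t + s')) \<in> V)"
  shows "\<exists>H. compact_abelian_group X H \<and> \<one>\<^bsub>H\<^esub> = j 0 \<and> (\<forall>t s. j t \<otimes>\<^bsub>H\<^esub> j s = j (s + t))"
proof -
  let ?XX = "prod_topology X X"
  have unif: "uniform_structure_on (topspace X) \<U>"
    using comp by (simp add: compatible_uniformity_def)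
  have dense2: "?XX closure_of range (\<lambda>(s, t). (j s, j t)) = topspace ?XX"
  proof -
    have "range (\<lambda>(s, t). (j s, j t)) = range j \<times> range j" by auto
    then show ?thesis by (simp add: closure_of_Times j(2))
  qed
  have dense3: "prod_topology X ?XX closure_of range (\<lambda>(s, t, u). (j s, j t, j u)) = topspace (prod_topology X ?XX)"
  proof -
    have "(j s, j t, j u) \<in> range (\<lambda>(s, t, u). (j s, j t, j u))" for s t u
      by (rule range_eqI[of _ _ "(s, t, u)"]) simp
    then have "range (\<lambda>(s, t, u). (j s, j t, j u)) = range j \<times> (range j \<times> range j)" by auto
    then show ?thesis by (simp add: closure_of_Times j(2))
  qed
  have small: "\<exists>P. openin X P \<and> x \<in> P \<and> (\<forall>s s'. j s \<in> P \<longrightarrow> j s' \<in> P \<longrightarrow> (\<forall>t. (j (t + s), j (t + s')) \<in> V))"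
    if x: "x \<in> topspace X" and V: "V \<in> \<U>" for x V
  proof -
    obtain U where U: "U \<in> \<U>" "\<And>s s' t. (j s, j s') \<in> U \<Longrightarrow> (j (t + s), j (t + s')) \<in> V"
      using equi[OF V] by metis
    obtain E where E: "E \<in> \<U>" "E\<inverse> = E" "E O E \<subseteq> U"
      using uniform_structure_symmetric_half[OF unif U(1)] by metis
    obtain P where P: "openin X P" "x \<in> P" "P \<subseteq> E `` {x}"
      using compatible_uniformity_interior[OF comp E(1) x] by metis
    have "(j s, j s') \<in> U" if "j s \<in> P" "j s' \<in> P" for s s'
    proof -
      have "(x, j s) \<in> E" "(x, j s') \<in> E" using P(3) that by auto
      then have "(j s, x) \<in> E" "(x, j s') \<in> E" using E(2) by blast+
      then show ?thesis using E(3) by blast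
    qed
    then show ?thesis using P(1,2) by (intro exI[of _ P]) (auto intro: U(2))
  qed
  obtain g where g: "continuous_map ?XX X g" "\<And>p. g (case p of (s, t) \<Rightarrow> (j s, j t)) = (case p of (s, t) \<Rightarrow> j (s + t))"
  proof (rule extend_from_dense[OF X comp, of "\<lambda>(s, t). (j s, j t)" ?XX "\<lambda>(s, t). j (s + t)"])
    show "(case p of (s, t) \<Rightarrow> (j s, j t)) \<in> topspace ?XX" for p using j(1) by (auto split: prod.split)
    show "(case p of (s, t) \<Rightarrow> j (s + t)) \<in> topspace X" for p using j(1) by (auto split: prod.split)
    fix y V assume y: "y \<in> topspace ?XX" and V: "V \<in> \<U>"
    obtain x1 x2 where x: "y = (x1, x2)" "x1 \<in> topspace X" "x2 \<in> topspace X" using y by auto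
    obtain E where E: "E \<in> \<U>" "E O E \<subseteq> V"
      using uniform_structure_symmetric_half[OF unif V] by metis
    obtain P where P: "openin X P" "x1 \<in> P" "\<And>s s' t. j s \<in> P \<Longrightarrow> j s' \<in> P \<Longrightarrow> (j (t + s), j (t + s')) \<in> E"
      using small[OF x(2) E(1)] by metis
    obtain Q where Q: "openin X Q" "x2 \<in> Q" "\<And>s s' t. j s \<in> Q \<Longrightarrow> j s' \<in> Q \<Longrightarrow> (j (t + s), j (t + s')) \<in> E"
      using small[OF x(3) E(1)] by metis
    have "(j (s + t), j (s' + t')) \<in> V"
      if "j s \<in> P" "j t \<in> Q" "j s' \<in> P" "j t' \<in> Q" for s t s' t'
    proof -
      have "(j (s + t), j (s' + t)) \<in> E" using P(3)[OF that(1,3), of t] by (simp add: add.commute)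
      moreover have "(j (s' + t), j (s' + t')) \<in> E" by (rule Q(3)[OF that(2,4)])
      ultimately show ?thesis using E(2) by blast
    qed
    then show "\<exists>R. openin ?XX R \<and> y \<in> R \<and> (\<forall>p p'. (case p of (s, t) \<Rightarrow> (j s, j t)) \<in> R \<longrightarrow>
        (case p' of (s, t) \<Rightarrow> (j s, j t)) \<in> R \<longrightarrow>
        (case p of (s, t) \<Rightarrow> j (s + t), case p' of (s, t) \<Rightarrow> j (s + t)) \<in> V)"
      using P(1,2) Q(1,2) x(1)
      by (intro exI[of _ "P \<times> Q"]) (auto simp: openin_prod_Times_iff)
  qed (rule dense2, rule that)
  have g_j: "g (j s, j t) = j (s + t)" for s t using g(2)[of "(s, t)"] by simp
  obtain h where h: "continuous_map X X h" "\<And>s. h (j s) = j (- s)"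
  proof (rule extend_from_dense[OF X comp, of j X "\<lambda>s. j (- s)"])
    fix y V assume y: "y \<in> topspace X" and V: "V \<in> \<U>"
    obtain P where P: "openin X P" "y \<in> P" "\<And>s s' t. j s \<in> P \<Longrightarrow> j s' \<in> P \<Longrightarrow> (j (t + s), j (t + s')) \<in> V"
      using small[OF y V] by metis
    have "(j (- s), j (- s')) \<in> V" if "j s \<in> P" "j s' \<in> P" for s s'
      using P(3)[OF that(2,1), of "- s - s'"] by (simp add: algebra_simps)
    then show "\<exists>P. openin X P \<and> y \<in> P \<and> (\<forall>s s'. j s \<in> P \<longrightarrow> j s' \<in> P \<longrightarrow> (j (- s), j (- s')) \<in> V)"
      using P(1,2) by (intro exI[of _ P]) auto
  qed (use j in auto)
  define H where "H = \<lparr>carrier = topspace X, monoid.mult = (\<lambda>x y. g (x, y)), one = j 0\<rparr>"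
  have g_in: "g (x, y) \<in> topspace X" if "x \<in> topspace X" "y \<in> topspace X" for x y
    using continuous_map_funspace[OF g(1)] that by auto
  have h_in: "h x \<in> topspace X" if "x \<in> topspace X" for x
    using continuous_map_funspace[OF h(1)] that by auto
  have projections: "continuous_map ?XX X fst" "continuous_map ?XX X snd"
    by (simp_all add: continuous_map_fst continuous_map_snd)
  have projections3: "continuous_map (prod_topology X ?XX) X fst"
      "continuous_map (prod_topology X ?XX) X (\<lambda>p. fst (snd p))"
      "continuous_map (prod_topology X ?XX) X (\<lambda>p. snd (snd p))"
    using continuous_map_compose[OF continuous_map_snd projections(1), of X]
      continuous_map_compose[OF continuous_map_snd projections(2), of X]
    by (simp_all add: continuous_map_fst o_def)
  have pair2: "continuous_map ?XX X (\<lambda>y. g (a y, b y))"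
    if "continuous_map ?XX X a" "continuous_map ?XX X b" for a b
    using continuous_map_compose[OF _ g(1), of ?XX "\<lambda>y. (a y, b y)"] that
    by (simp add: continuous_map_pairwise o_def)
  have pair3: "continuous_map (prod_topology X ?XX) X (\<lambda>y. g (a y, b y))"
    if "continuous_map (prod_topology X ?XX) X a" "continuous_map (prod_topology X ?XX) X b" for a b
    using continuous_map_compose[OF _ g(1), of "prod_topology X ?XX" "\<lambda>y. (a y, b y)"] that
    by (simp add: continuous_map_pairwise o_def)
  have pair1: "continuous_map X X (\<lambda>y. g (a y, b y))" if "continuous_map X X a" "continuous_map X X b" for a b
    using continuous_map_compose[OF _ g(1), of X "\<lambda>y. (a y, b y)"] that
    by (simp add: continuous_map_pairwise o_def)
  have comm: "g (x, y) = g (y, x)" if "x \<in> topspace X" "y \<in> topspace X" for x y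
  proof -
    have "(\<lambda>p. g (fst p, snd p)) (x, y) = (\<lambda>p. g (snd p, fst p)) (x, y)"
      by (rule forall_in_closure_of_eq[OF _ X(2) pair2[OF projections] pair2[OF projections(2,1)],
            of _ "range (\<lambda>(s, t). (j s, j t))"])
        (use that in \<open>auto simp: dense2 g_j add.commute\<close>)
    then show ?thesis by simp
  qed
  have assoc: "g (g (x, y), z) = g (x, g (y, z))"
    if "x \<in> topspace X" "y \<in> topspace X" "z \<in> topspace X" for x y z
  proof -
    have "(\<lambda>p. g (g (fst p, fst (snd p)), snd (snd p))) (x, y, z) = (\<lambda>p. g (fst p, g (fst (snd p), snd (snd p)))) (x, y, z)"
      by (rule forall_in_closure_of_eq[OF _ X(2) pair3[OF pair3[OF projections3(1,2)] projections3(3)]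
            pair3[OF projections3(1) pair3[OF projections3(2,3)]], of _ "range (\<lambda>(s, t, u). (j s, j t, j u))"])
        (use that in \<open>auto simp: dense3 g_j add.assoc\<close>)
    then show ?thesis by simp
  qed
  have unit: "g (j 0, x) = x" if "x \<in> topspace X" for x
    by (rule forall_in_closure_of_eq[OF _ X(2) pair1 continuous_map_id[unfolded id_def], of _ "range j"])
      (use that j in \<open>auto simp: g_j continuous_map_const\<close>)
  have inverse: "g (h x, x) = j 0" if "x \<in> topspace X" for x
    by (rule forall_in_closure_of_eq[OF _ X(2) pair1[OF h(1) continuous_map_id[unfolded id_def]], of _ "range j"])
      (use that j h(2) in \<open>auto simp: g_j continuous_map_const\<close>)
  have group: "comm_group H"
  proof (rule comm_groupI)
    show "\<exists>y\<in>carrier H. y \<otimes>\<^bsub>H\<^esub> x = \<one>\<^bsub>H\<^esub>" if "x \<in> carrier H" for x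
      using that inverse h_in by (intro bexI[of _ "h x"]) (auto simp: H_def)
    show "x \<otimes>\<^bsub>H\<^esub> y = y \<otimes>\<^bsub>H\<^esub> x" if "x \<in> carrier H" "y \<in> carrier H" for x y
      using that comm by (simp add: H_def)
  qed (use g_in assoc unit j(1) in \<open>auto simp: H_def\<close>)
  interpret H: comm_group H by (rule group)
  have inv_h: "inv\<^bsub>H\<^esub> x = h x" if "x \<in> topspace X" for x
    using that inverse h_in by (intro H.inv_equality) (auto simp: H_def)
  have "continuous_map X X (\<lambda>x. inv\<^bsub>H\<^esub> x)"
    by (rule continuous_map_eq[OF h(1)]) (simp add: inv_h)
  moreover have "continuous_map ?XX X (\<lambda>(x, y). x \<otimes>\<^bsub>H\<^esub> y)"
    using g(1) by (simp add: H_def split_def)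
  ultimately have "compact_abelian_group X H"
    using group X by (simp add: compact_abelian_group_def H_def)
  then show ?thesis
    by (intro exI[of _ H]) (auto simp: H_def g_j add.commute)
qed

text \<open>The elements \<open>y\<close> that move \<open>\<Psi>\<close> uniformly by less than \<open>\<epsilon>\<close> form a neighbourhood of the identity,
  because projection along the compact space \<open>X\<close> is closed; finitely many translates of it by orbit
  points cover \<open>X\<close>.\<close>

lemma compact_group_finite_translates:
  fixes j :: "'g::ab_group_add \<Rightarrow> 'a" and \<Psi> :: "'a \<Rightarrow> complex"
  assumes H: "compact_abelian_group X H"
    and j: "\<And>t. j t \<in> topspace X" "X closure_of range j = topspace X"
    and one: "\<one>\<^bsub>H\<^esub> = j 0" and mult: "\<And>t s. j t \<otimes>\<^bsub>H\<^esub> j s = j (s + t)"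
    and \<Psi>: "continuous_map X euclidean \<Psi>" and "\<epsilon> > 0"
  obtains F where "finite F" "\<And>t. \<exists>f\<in>F. \<forall>s. cmod (\<Psi> (j (s + (t - f))) - \<Psi> (j s)) < \<epsilon>"
proof -
  let ?XX = "prod_topology X X"
  have group: "comm_group H" and carrier: "carrier H = topspace X" and X: "compact_space X"
    and cmult: "continuous_map ?XX X (\<lambda>(x, y). x \<otimes>\<^bsub>H\<^esub> y)" and cinv: "continuous_map X X (\<lambda>x. inv\<^bsub>H\<^esub> x)"
    using H by (auto simp: compact_abelian_group_def)
  interpret H: comm_group H by (rule group)
  define D where "D = {p \<in> topspace ?XX. \<epsilon> \<le> cmod (\<Psi> (fst p \<otimes>\<^bsub>H\<^esub> snd p) - \<Psi> (snd p))}"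
  have "continuous_map ?XX euclidean (\<lambda>p. \<Psi> (fst p \<otimes>\<^bsub>H\<^esub> snd p))"
    using continuous_map_compose[OF cmult \<Psi>] by (simp add: o_def split_def)
  moreover have "continuous_map ?XX euclidean (\<lambda>p. \<Psi> (snd p))"
    using continuous_map_compose[OF continuous_map_snd \<Psi>] by (simp add: o_def)
  ultimately have "continuous_map ?XX euclidean (\<lambda>p. cmod (\<Psi> (fst p \<otimes>\<^bsub>H\<^esub> snd p) - \<Psi> (snd p)))"
    by (intro continuous_map_norm continuous_map_diff)
  then have "closedin ?XX {p \<in> topspace ?XX. cmod (\<Psi> (fst p \<otimes>\<^bsub>H\<^esub> snd p) - \<Psi> (snd p)) \<in> {\<epsilon>..}}"
    by (rule closedin_continuous_map_preimage) simp
  then have "closedin ?XX D" by (simp add: D_def)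
  then have "closedin X (fst ` D)"
    using closed_map_fst[OF X, of X] by (auto simp: closed_map_def)
  then have N: "openin X (topspace X - fst ` D)" by blast
  define N where "N = topspace X - fst ` D"
  have N_small: "cmod (\<Psi> (y \<otimes>\<^bsub>H\<^esub> x) - \<Psi> x) < \<epsilon>" if "y \<in> N" "x \<in> topspace X" for x y
  proof (rule ccontr)
    assume "\<not> cmod (\<Psi> (y \<otimes>\<^bsub>H\<^esub> x) - \<Psi> x) < \<epsilon>"
    then have "(y, x) \<in> D" using that by (auto simp: D_def N_def)
    then have "y \<in> fst ` D" by force
    then show False using that(1) by (simp add: N_def)
  qed
  have one_N: "\<one>\<^bsub>H\<^esub> \<in> N"
    using H.one_closed H.l_one \<open>\<epsilon> > 0\<close> unfolding N_def D_def carrier by auto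
  have shift: "continuous_map X X (\<lambda>x. a x \<otimes>\<^bsub>H\<^esub> b x)" if "continuous_map X X a" "continuous_map X X b" for a b
    using continuous_map_compose[OF _ cmult, of X "\<lambda>y. (a y, b y)"] that
    by (simp add: continuous_map_pairwise o_def)
  define N' where "N' t = {x \<in> topspace X. x \<otimes>\<^bsub>H\<^esub> j (- t) \<in> N}" for t
  have N'_open: "openin X (N' t)" for t
    unfolding N'_def N_def
    by (intro openin_continuous_map_preimage[OF shift N]) (auto simp: j continuous_map_const)
  have inv_j: "inv\<^bsub>H\<^esub> (j t) = j (- t)" for t
    by (rule H.inv_equality) (auto simp: mult one j carrier)
  have cover: "topspace X \<subseteq> (\<Union>t. N' t)"
  proof
    fix x assume x: "x \<in> topspace X"
    have op: "openin X {y \<in> topspace X. x \<otimes>\<^bsub>H\<^esub> inv\<^bsub>H\<^esub> y \<in> N}"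
      unfolding N_def by (intro openin_continuous_map_preimage[OF shift[OF _ cinv] N]) (auto simp: x continuous_map_const)
    have mem: "x \<in> {y \<in> topspace X. x \<otimes>\<^bsub>H\<^esub> inv\<^bsub>H\<^esub> y \<in> N}"
      using x one_N by (simp add: carrier)
    have cl: "x \<in> X closure_of range j" using x j(2) by simp
    obtain y where "y \<in> range j" "y \<in> {y \<in> topspace X. x \<otimes>\<^bsub>H\<^esub> inv\<^bsub>H\<^esub> y \<in> N}"
      by (rule closure_of_meets[OF cl op mem])
    then obtain t where "x \<otimes>\<^bsub>H\<^esub> inv\<^bsub>H\<^esub> (j t) \<in> N" by auto
    then show "x \<in> (\<Union>t. N' t)" using x by (auto simp: N'_def inv_j)
  qed
  obtain F where F: "finite F" "topspace X \<subseteq> (\<Union>t\<in>F. N' t)"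
  proof -
    have "\<forall>U\<in>range N'. openin X U" using N'_open by auto
    then obtain \<F> where \<F>: "finite \<F>" "\<F> \<subseteq> range N'" "topspace X \<subseteq> \<Union>\<F>"
      using X cover unfolding compact_space_alt by metis
    then obtain F where "finite F" "\<F> = N' ` F"
      using finite_subset_image[of \<F> N' UNIV] by blast
    with \<F>(3) show thesis by (intro that) auto
  qed
  have "\<exists>f\<in>F. \<forall>s. cmod (\<Psi> (j (s + (t - f))) - \<Psi> (j s)) < \<epsilon>" for t
  proof -
    obtain f where f: "f \<in> F" "j t \<in> N' f" using F(2) j(1)[of t] by blast
    then have "j (t - f) \<in> N" by (simp add: N'_def mult)
    then have "cmod (\<Psi> (j (s + (t - f))) - \<Psi> (j s)) < \<epsilon>" for s
      using N_small[OF _ j(1), of "j (t - f)" s] by (simp add: mult)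
    with f(1) show ?thesis by (intro bexI[of _ f]) auto
  qed
  with F(1) show thesis by (rule that)
qed


section \<open>Total boundedness of the translates of an almost periodic function\<close>

text \<open>On a compact set continuity is uniform, also in directions that leave the set.\<close>

lemma uniformly_continuous_near_compact:
  fixes f :: "'g::topological_ab_group_add \<Rightarrow> complex"
  assumes f: "continuous_on UNIV f" and K: "compact K" and "\<delta> > 0"
  obtains W where "open W" "0 \<in> W" "\<And>k w. k \<in> K \<Longrightarrow> w \<in> W \<Longrightarrow> cmod (f (k + w) - f k) < \<delta>"
proof -
  have "\<exists>A B. open A \<and> open B \<and> k \<in> A \<and> 0 \<in> B \<and> (\<forall>a\<in>A. \<forall>b\<in>B. cmod (f (a + b) - f k) < \<delta> / 2)" for k
  proof -
    have "continuous_on UNIV (\<lambda>p. f (fst p + snd p))"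
      by (intro continuous_on_compose2[OF f] continuous_intros) auto
    then have "open ((\<lambda>p. f (fst p + snd p)) -` ball (f k) (\<delta> / 2))"
      by (intro open_vimage) auto
    moreover have "(k, 0) \<in> (\<lambda>p. f (fst p + snd p)) -` ball (f k) (\<delta> / 2)"
      using \<open>\<delta> > 0\<close> by simp
    ultimately obtain A B where AB: "open A" "open B" "(k, 0) \<in> A \<times> B"
        "A \<times> B \<subseteq> (\<lambda>p. f (fst p + snd p)) -` ball (f k) (\<delta> / 2)"
      by (rule open_prod_elim)
    have "cmod (f (a + b) - f k) < \<delta> / 2" if "a \<in> A" "b \<in> B" for a b
    proof -
      have "(a, b) \<in> (\<lambda>p. f (fst p + snd p)) -` ball (f k) (\<delta> / 2)" using AB(4) that by blast
      then show ?thesis by (simp add: dist_norm norm_minus_commute)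
    qed
    then show ?thesis using AB(1-3) by (intro exI[of _ A] exI[of _ B]) auto
  qed
  then obtain A B where AB: "\<And>k. open (A k)" "\<And>k. open (B k)" "\<And>k. k \<in> A k" "\<And>k. 0 \<in> B k"
      "\<And>k a b. a \<in> A k \<Longrightarrow> b \<in> B k \<Longrightarrow> cmod (f (a + b) - f k) < \<delta> / 2" by metis
  obtain D where D: "D \<subseteq> K" "finite D" "K \<subseteq> (\<Union>k\<in>D. A k)"
    by (rule compactE_image[OF K, of K A]) (use AB(1,3) in auto)
  show thesis
  proof
    show "open (\<Inter>k\<in>D. B k)" using D(2) AB(2) by (intro open_INT) auto
    show "0 \<in> (\<Inter>k\<in>D. B k)" using AB(4) by auto
    fix k w assume k: "k \<in> K" and w: "w \<in> (\<Inter>k\<in>D. B k)"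
    obtain d where d: "d \<in> D" "k \<in> A d" using D(3) k by blast
    have "cmod (f (k + w) - f d) < \<delta> / 2" using AB(5)[OF d(2)] w d(1) by blast
    moreover have "cmod (f k - f d) < \<delta> / 2" using AB(5)[OF d(2) AB(4)] by simp
    ultimately show "cmod (f (k + w) - f k) < \<delta>"
      using norm_triangle_ineq4[of "f (k + w) - f d" "f k - f d"] by simp
  qed
qed

text \<open>Every \<open>t\<close> is an almost period plus an element of a compact set \<open>K\<close>.  Uniform continuity of \<open>f\<close> near \<open>K\<close>
  therefore spreads to the whole group, and then \<open>K\<close> may be replaced by finitely many of its points.\<close>

lemma bohr_totally_bounded:
  fixes f :: "'g::topological_ab_group_add \<Rightarrow> complex"
  assumes f: "bohr_almost_periodic f" and "\<epsilon> > 0"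
  obtains F where "finite F" "\<And>t. \<exists>u\<in>F. \<forall>s. cmod (f (s + t) - f (s + u)) \<le> \<epsilon>"
proof -
  \<comment> \<open>One error \<open>\<delta>\<close> for the almost period, and \<open>3 * \<delta>\<close> for uniform continuity.\<close>
  define \<delta> where "\<delta> = \<epsilon> / 4"
  have \<delta>: "\<delta> > 0" using \<open>\<epsilon> > 0\<close> by (simp add: \<delta>_def)
  have cont: "continuous_on UNIV f" and bdd: "bounded (range f)"
    and dense: "relatively_dense {t. (SUP s. cmod (f (s - t) - f s)) \<le> \<delta>}"
    using f \<delta> unfolding bohr_almost_periodic_def by auto
  obtain K where K: "compact K" "{r + k |r k. r \<in> {t. (SUP s. cmod (f (s - t) - f s)) \<le> \<delta>} \<and> k \<in> K} = UNIV"
    using dense unfolding relatively_dense_def by blast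
  obtain B where B: "\<And>x. cmod (f x) \<le> B" using bdd by (auto simp: bounded_iff)
  have period: "cmod (f (s - r) - f s) \<le> \<delta>" if r: "(SUP s. cmod (f (s - r) - f s)) \<le> \<delta>" for r s
  proof -
    have "cmod (f (s - r) - f s) \<le> 2 * B" for s
      using norm_triangle_ineq4[of "f (s - r)" "f s"] B[of "s - r"] B[of s] by simp
    then have "bdd_above (range (\<lambda>s. cmod (f (s - r) - f s)))" by (auto simp: bdd_above_def)
    then have "cmod (f (s - r) - f s) \<le> (SUP s. cmod (f (s - r) - f s))" by (intro cSUP_upper) auto
    with r show ?thesis by simp
  qed
  have split: "\<exists>r k. t = r + k \<and> k \<in> K \<and> (\<forall>s. cmod (f (s - r) - f s) \<le> \<delta>)" for t
  proof -
    have "t \<in> {r + k |r k. r \<in> {t. (SUP s. cmod (f (s - t) - f s)) \<le> \<delta>} \<and> k \<in> K}" using K(2) by simp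
    then obtain r k where "t = r + k" "(SUP s. cmod (f (s - r) - f s)) \<le> \<delta>" "k \<in> K" by blast
    then show ?thesis using period by blast
  qed
  obtain W where W: "open W" "0 \<in> W" "\<And>k w. k \<in> K \<Longrightarrow> w \<in> W \<Longrightarrow> cmod (f (k + w) - f k) < \<delta>"
    using uniformly_continuous_near_compact[OF cont K(1) \<delta>] by metis
  have unif: "cmod (f (s + w) - f s) \<le> 3 * \<delta>" if w: "w \<in> W" for s w
  proof -
    obtain r k where rk: "s = r + k" "k \<in> K" "\<And>s. cmod (f (s - r) - f s) \<le> \<delta>" using split[of s] by blast
    have "cmod (f (k + w) - f (s + w)) \<le> \<delta>" using rk(3)[of "s + w"] by (simp add: rk(1))
    moreover have "cmod (f k - f s) \<le> \<delta>" using rk(3)[of s] by (simp add: rk(1))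
    moreover have "cmod (f (k + w) - f k) \<le> \<delta>" using W(3)[OF rk(2) w] by simp
    moreover have "f (s + w) - f s = ((f (k + w) - f k) + (f k - f s)) - (f (k + w) - f (s + w))" by simp
    ultimately show ?thesis
      using norm_triangle_ineq4[of "(f (k + w) - f k) + (f k - f s)" "f (k + w) - f (s + w)"]
        norm_triangle_ineq[of "f (k + w) - f k" "f k - f s"] by simp
  qed
  obtain F where F: "finite F" "K \<subseteq> (\<Union>k\<in>F. {a. a - k \<in> W})"
  proof (rule compactE_image[OF K(1), of K "\<lambda>k. {a. a - k \<in> W}"])
    show "open {a. a - k \<in> W}" for k by (rule open_translate[OF W(1)])
    show "K \<subseteq> (\<Union>k\<in>K. {a. a - k \<in> W})" using W(2) by auto
  qed (use that in blast)
  have "\<exists>u\<in>F. \<forall>s. cmod (f (s + t) - f (s + u)) \<le> \<epsilon>" for t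
  proof -
    obtain r k where rk: "t = r + k" "k \<in> K" "\<And>s. cmod (f (s - r) - f s) \<le> \<delta>" using split[of t] by blast
    obtain u where u: "u \<in> F" "k - u \<in> W" using F(2) rk(2) by blast
    have "cmod (f (s + t) - f (s + u)) \<le> \<epsilon>" for s
    proof -
      have "cmod (f (s + k) - f (s + t)) \<le> \<delta>"
        using rk(3)[of "s + t"] by (simp add: rk(1) algebra_simps)
      moreover have "cmod (f (s + k) - f (s + u)) \<le> 3 * \<delta>"
        using unif[OF u(2), of "s + u"] by (simp add: algebra_simps)
      ultimately show ?thesis
        using norm_triangle_ineq4[of "f (s + k) - f (s + u)" "f (s + k) - f (s + t)"] by (simp add: \<delta>_def)
    qed
    with u(1) show ?thesis by (intro bexI[of _ u]) auto
  qed
  with F(1) show thesis by (rule that)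
qed

section \<open>The hull of a separated set\<close>

text \<open>All constructions on the hull refer to one neighbourhood \<open>V\<close> that witnesses uniform discreteness of \<open>L\<close>.\<close>

locale separated_set =
  fixes V L :: "'g::{topological_ab_group_add, t2_space} set"
  assumes lc: "locally_compact_space (euclidean :: 'g topology)"
    and V: "open V" "0 \<in> V" and L: "separated_by V L"
begin

definition orbit :: "'g \<Rightarrow> 'g set \<Rightarrow> complex" where
  "orbit t = delta ((+) t ` L)"

lemma locally_finite_separated: "separated_by V M \<Longrightarrow> locally_finite M"
  by (rule separated_by_locally_finite[OF V])

lemma delta_separated: "separated_by V M \<Longrightarrow> delta M \<in> complex_measures"
  by (intro delta_complex_measure[OF lc] locally_finite_separated)

lemma closedin_separated: "closedin vague_topology (delta ` {M. separated_by V M})"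
  using compactin_vague_separated[OF lc V] Hausdorff_vague[OF lc] by (rule compactin_imp_closedin[rotated])

lemma hull_eq: "measure_hull L = vague_topology closure_of range orbit"
  by (simp add: measure_hull_def orbit_def[abs_def])

text \<open>Compactness of the right-hand side makes it closed, as the vague topology is Hausdorff.\<close>

lemma hull_subset: "measure_hull L \<subseteq> delta ` {M. separated_by V M}"
  unfolding hull_eq
  by (rule closure_of_minimal[OF _ closedin_separated]) (auto simp: orbit_def separated_by_translate L)

lemma hull_measures: "measure_hull L \<subseteq> complex_measures"
  using hull_subset delta_separated by blast

lemma topspace_hull: "topspace (hull_topology L) = measure_hull L"
  using hull_measures by (auto simp: hull_topology_def)

lemma hull_delta:
  assumes "\<nu> \<in> measure_hull L"
  obtains M where "separated_by V M" "\<nu> = delta M"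
  using assms hull_subset by blast

lemma compact_hull: "compact_space (hull_topology L)"
proof -
  have "closedin vague_topology (measure_hull L)" by (simp add: hull_eq)
  then have "compactin vague_topology (measure_hull L)"
    using closed_compactin[OF compactin_vague_separated[OF lc V] hull_subset] by blast
  then show ?thesis by (simp add: hull_topology_def compact_space_subtopology)
qed

lemma Hausdorff_hull: "Hausdorff_space (hull_topology L)"
  unfolding hull_topology_def by (rule Hausdorff_space_subtopology[OF Hausdorff_vague[OF lc]])

lemma orbit_measures: "range orbit \<subseteq> complex_measures"
  by (auto simp: orbit_def intro: delta_separated separated_by_translate[OF L])

lemma orbit_in_hull: "orbit t \<in> measure_hull L"
  using closure_of_subset[of "range orbit" vague_topology] orbit_measures by (auto simp: hull_eq)

lemma orbit_dense: "hull_topology L closure_of range orbit = topspace (hull_topology L)"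
proof -
  have "measure_hull L \<inter> range orbit = range orbit" using orbit_in_hull by blast
  then show ?thesis
    unfolding topspace_hull by (simp add: hull_topology_def closure_of_subtopology hull_eq[symmetric])
qed

lemma translate_orbit: "translate t (orbit s) = orbit (t + s)"
  by (simp add: orbit_def translate_delta image_image add.assoc)

lemma continuous_hull_integral:
  "\<phi> \<in> Cc \<Longrightarrow> continuous_map (hull_topology L) euclidean (\<lambda>\<nu>. complex_integral \<nu> \<phi>)"
  unfolding hull_topology_def
  by (intro continuous_map_from_subtopology continuous_map_vague_integral)

lemma integral_translate:
  assumes \<nu>: "\<nu> \<in> measure_hull L" and \<phi>: "\<phi> \<in> Cc"
  shows "complex_integral (translate t \<nu>) \<phi> = complex_integral \<nu> (\<lambda>u. \<phi> (t + u))"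
proof -
  obtain M where M: "separated_by V M" "\<nu> = delta M" using hull_delta[OF \<nu>] by metis
  have "complex_integral (translate t \<nu>) \<phi> = (\<Sum>\<^sub>\<infinity>x\<in>(+) t ` M. \<phi> x)"
    unfolding M(2) translate_delta
    by (intro complex_integral_delta[OF lc _ \<phi>] locally_finite_separated separated_by_translate M)
  also have "\<dots> = (\<Sum>\<^sub>\<infinity>x\<in>M. \<phi> (t + x))"
    by (subst infsum_reindex) (auto simp: o_def)
  also have "\<dots> = complex_integral \<nu> (\<lambda>u. \<phi> (t + u))"
    unfolding M(2)
    by (intro complex_integral_delta[OF lc _ Cc_translate[OF \<phi>], symmetric] locally_finite_separated M)
  finally show ?thesis .
qed

text \<open>On the hull, whose elements are all point measures, translation by \<open>t\<close> is vaguely continuous: it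
  replaces \<open>\<phi>\<close> by \<open>\<phi>(t + u)\<close>.  It maps the orbit to itself, hence also the closure.\<close>

lemma translate_in_hull:
  assumes "\<nu> \<in> measure_hull L"
  shows "translate t \<nu> \<in> measure_hull L"
proof -
  have meas: "translate t \<mu> \<in> complex_measures" if \<mu>: "\<mu> \<in> measure_hull L" for \<mu>
  proof -
    obtain M where M: "separated_by V M" "\<mu> = delta M" using hull_delta[OF \<mu>] by metis
    then show ?thesis by (simp add: translate_delta delta_separated separated_by_translate)
  qed
  have "continuous_map (hull_topology L) vague_topology (translate t)"
  proof (rule continuous_map_into_vague)
    show "translate t \<mu> \<in> complex_measures" if "\<mu> \<in> topspace (hull_topology L)" for \<mu>
      using that meas by (simp add: topspace_hull)
    show "continuous_map (hull_topology L) euclidean (\<lambda>\<mu>. complex_integral (translate t \<mu>) \<phi>)"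
      if \<phi>: "\<phi> \<in> Cc" for \<phi>
      by (rule continuous_map_eq[OF continuous_hull_integral[OF Cc_translate[OF \<phi>, of t]]])
        (simp add: topspace_hull integral_translate \<phi>)
  qed
  then have "translate t ` (hull_topology L closure_of range orbit) \<subseteq> vague_topology closure_of (translate t ` range orbit)"
    by (rule continuous_map_image_closure_subset)
  moreover have "translate t ` range orbit \<subseteq> range orbit" by (auto simp: translate_orbit)
  then have "vague_topology closure_of (translate t ` range orbit) \<subseteq> measure_hull L"
    unfolding hull_eq by (rule closure_of_mono)
  ultimately show ?thesis using assms by (auto simp: orbit_dense topspace_hull)
qed

text \<open>The function \<open>t \<mapsto> \<Sum> \<phi>(t - x)\<close> reads the integral of the reflected \<open>\<phi>\<close> along the orbit.\<close>

lemma orbit_integral: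
  assumes \<phi>: "\<phi> \<in> Cc"
  shows "complex_integral (orbit (- t)) (\<lambda>u. \<phi> (0 - u)) = (\<Sum>\<^sub>\<infinity>x\<in>L. \<phi> (t - x))"
proof -
  have "complex_integral (orbit (- t)) (\<lambda>u. \<phi> (0 - u)) = (\<Sum>\<^sub>\<infinity>x\<in>(+) (- t) ` L. \<phi> (0 - x))"
    unfolding orbit_def
    by (intro complex_integral_delta[OF lc _ Cc_reflect[OF \<phi>]] locally_finite_separated
        separated_by_translate L)
  also have "\<dots> = (\<Sum>\<^sub>\<infinity>x\<in>L. \<phi> (t - x))"
    by (subst infsum_reindex) (auto simp: o_def)
  finally show ?thesis .
qed

lemma convolution_delta:
  "\<phi> \<in> Cc \<Longrightarrow> convolution (delta L) \<phi> = (\<lambda>t. \<Sum>\<^sub>\<infinity>x\<in>L. \<phi> (t - x))"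
  unfolding convolution_def
  by (intro ext complex_integral_delta[OF lc] locally_finite_separated L Cc_reflect)

lemma translation_bounded_delta: "translation_bounded (delta L)"
proof -
  obtain W where W: "open W" "0 \<in> W" "\<And>a b. a \<in> W \<Longrightarrow> b \<in> W \<Longrightarrow> a - b \<in> V"
    using open_half_neighbourhood[OF V] by metis
  obtain P where P: "open P" "compact (closure P)" "{0::'g} \<subseteq> P"
    using compact_neighbourhood[OF lc, of "{0}"] by (metis compact_insert compact_empty)
  define U where "U = W \<inter> P"
  have "U \<in> rc_borel"
    using W(1) P closure_subset[of P] by (intro rc_borel_subset_compact[of U "closure P"]) (auto simp: U_def)
  then have U: "open U" "U \<noteq> {}" "compact (closure U)"
    using W P by (auto simp: U_def rc_borel_def)
  have "total_variation (delta L) ((+) t ` U) \<le> ennreal 1" for t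
  proof -
    have "x = y" if "x \<in> L \<inter> (+) t ` U" "y \<in> L \<inter> (+) t ` U" for x y
    proof -
      have "(x - t) - (y - t) \<in> V" using that by (intro W(3)) (auto simp: U_def)
      then show ?thesis using L that by (auto simp: separated_by_def)
    qed
    then have sub: "\<exists>a. L \<inter> (+) t ` U \<subseteq> {a}" by blast
    then have "finite (L \<inter> (+) t ` U)" by (meson finite.emptyI finite_insert finite_subset)
    then have "total_variation (delta L) ((+) t ` U) \<le> of_nat (card (L \<inter> (+) t ` U))"
      by (rule total_variation_delta_le[OF locally_finite_separated[OF L]])
    also have "card (L \<inter> (+) t ` U) \<le> 1"
      using sub by (metis card.empty card_insert_disjoint card_mono empty_iff finite.emptyI finite_insert One_nat_def)
    then have "of_nat (card (L \<inter> (+) t ` U)) \<le> (of_nat 1 :: ennreal)"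
      by (rule of_nat_mono)
    finally show ?thesis by simp
  qed
  then show ?thesis
    unfolding translation_bounded_def using U delta_separated[OF L]
    by (intro conjI exI[of _ U] exI[of _ "1::real"]) auto
qed

text \<open>Near a given \<open>t\<close> only the points of \<open>L\<close> in one fixed compact set contribute to the sum.\<close>

lemma continuous_orbit_function:
  assumes \<phi>: "\<phi> \<in> Cc"
  shows "continuous_on UNIV (\<lambda>t. \<Sum>\<^sub>\<infinity>x\<in>L. \<phi> (t - x))"
proof -
  obtain C where C: "compact C" "\<And>x. x \<notin> C \<Longrightarrow> \<phi> x = 0" using Cc_support[OF \<phi>] by metis
  have local: "\<exists>W. open W \<and> t0 \<in> W \<and> continuous_on W (\<lambda>t. \<Sum>\<^sub>\<infinity>x\<in>L. \<phi> (t - x))" for t0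
  proof -
    obtain W where W: "open W" "compact (closure W)" "{t0} \<subseteq> W"
      using compact_neighbourhood[OF lc, of "{t0}"] by (metis compact_insert compact_empty)
    define D where "D = (\<lambda>p. fst p - snd p) ` (closure W \<times> C)"
    have "compact D"
      unfolding D_def by (intro compact_continuous_image compact_Times W C continuous_intros)
    then have fin: "finite (L \<inter> D)" using locally_finite_separated[OF L] by (simp add: locally_finite_def)
    have "(\<Sum>\<^sub>\<infinity>x\<in>L. \<phi> (t - x)) = (\<Sum>x\<in>L \<inter> D. \<phi> (t - x))" if t: "t \<in> W" for t
    proof -
      have "\<phi> (t - x) = 0" if "x \<notin> D" for x
      proof (rule C(2), rule notI)
        assume "t - x \<in> C"
        moreover have "t \<in> closure W" using t closure_subset by blast
        ultimately have "x \<in> D" unfolding D_def by (intro image_eqI[of _ _ "(t, t - x)"]) auto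
        with that show False by simp
      qed
      then have "(\<Sum>\<^sub>\<infinity>x\<in>L. \<phi> (t - x)) = (\<Sum>\<^sub>\<infinity>x\<in>L \<inter> D. \<phi> (t - x))"
        by (intro infsum_cong_neutral) auto
      then show ?thesis using fin by simp
    qed
    moreover have "continuous_on W (\<lambda>t. \<Sum>x\<in>L \<inter> D. \<phi> (t - x))"
      by (intro continuous_on_sum continuous_on_compose2[OF Cc_continuous[OF \<phi>]] continuous_intros) auto
    ultimately have "continuous_on W (\<lambda>t. \<Sum>\<^sub>\<infinity>x\<in>L. \<phi> (t - x))"
      by (simp cong: continuous_on_cong)
    then show ?thesis using W by auto
  qed
  then obtain W where W: "\<And>t. open (W t)" "\<And>t. t \<in> W t"
      "\<And>t. continuous_on (W t) (\<lambda>t. \<Sum>\<^sub>\<infinity>x\<in>L. \<phi> (t - x))" by metis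
  have "(\<Union>t\<in>UNIV. W t) = UNIV" using W(2) by blast
  then show ?thesis
    using continuous_on_open_UN[of UNIV W "\<lambda>t. \<Sum>\<^sub>\<infinity>x\<in>L. \<phi> (t - x)"] W by simp
qed


end

section \<open>The equivalences\<close>

context separated_set
begin

lemma bohr_iff_strongly_almost_periodic:
  "(\<forall>\<phi>\<in>Cc. bohr_almost_periodic (\<lambda>t. \<Sum>\<^sub>\<infinity>x\<in>L. \<phi> (t - x))) \<longleftrightarrow> strongly_almost_periodic (delta L)"
  by (auto simp: strongly_almost_periodic_def translation_bounded_delta convolution_delta)

text \<open>On the orbit this is total boundedness of the translates of \<open>f\<close>; the inequality is a closed condition
  on \<open>\<nu>\<close>, so it passes to the whole hull.\<close>

lemma hull_finite_translates:
  assumes bohr: "\<forall>\<phi>\<in>Cc. bohr_almost_periodic (\<lambda>t. \<Sum>\<^sub>\<infinity>x\<in>L. \<phi> (t - x))"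
    and \<phi>: "\<phi> \<in> Cc" and "\<epsilon> > 0"
  obtains F where "finite F" "\<And>t. \<exists>u\<in>F. \<forall>\<nu>\<in>measure_hull L.
     cmod (complex_integral (translate t \<nu>) \<phi> - complex_integral (translate u \<nu>) \<phi>) \<le> \<epsilon>"
proof -
  \<comment> \<open>Reflecting \<open>\<phi>\<close> makes \<open>f\<close> the integral of \<open>\<phi>\<close> itself along the orbit.\<close>
  define f where "f t = (\<Sum>\<^sub>\<infinity>x\<in>L. \<phi> (0 - (t - x)))" for t
  have f_orbit: "f t = complex_integral (orbit (- t)) \<phi>" for t
    using orbit_integral[OF Cc_reflect[OF \<phi>, of 0], of t] by (simp add: f_def)
  have "bohr_almost_periodic f"
    unfolding f_def[abs_def] using bohr Cc_reflect[OF \<phi>, of 0] by (rule bspec)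
  then obtain F where F: "finite F" "\<And>t. \<exists>u\<in>F. \<forall>s. cmod (f (s + t) - f (s + u)) \<le> \<epsilon>"
    using bohr_totally_bounded[OF _ \<open>\<epsilon> > 0\<close>] by metis
  have "\<exists>u\<in>uminus ` F. \<forall>\<nu>\<in>measure_hull L.
     cmod (complex_integral (translate t \<nu>) \<phi> - complex_integral (translate u \<nu>) \<phi>) \<le> \<epsilon>" for t
  proof -
    obtain u where u: "u \<in> F" "\<And>s. cmod (f (s + - t) - f (s + u)) \<le> \<epsilon>" using F(2)[of "- t"] by blast
    let ?P = "\<lambda>\<nu>. cmod (complex_integral (translate t \<nu>) \<phi> - complex_integral (translate (- u) \<nu>) \<phi>) \<le> \<epsilon>"
    have "?P \<nu>" if "\<nu> \<in> measure_hull L" for \<nu>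
    proof (rule forall_in_closure_of[where P = ?P])
      show "\<nu> \<in> hull_topology L closure_of range orbit" using that by (simp add: orbit_dense topspace_hull)
      show "?P \<mu>" if \<mu>: "\<mu> \<in> range orbit" for \<mu>
      proof -
        obtain s where s: "\<mu> = orbit s" using \<mu> by blast
        show ?thesis using u(2)[of "- s"] by (simp add: s translate_orbit f_orbit add.commute)
      qed
      have "continuous_map (hull_topology L) euclidean
          (\<lambda>\<nu>. cmod (complex_integral \<nu> (\<lambda>v. \<phi> (t + v)) - complex_integral \<nu> (\<lambda>v. \<phi> (- u + v))))"
        by (intro continuous_map_norm continuous_map_diff continuous_hull_integral Cc_translate \<phi>)
      then have "closedin (hull_topology L) {\<nu> \<in> topspace (hull_topology L).
          cmod (complex_integral \<nu> (\<lambda>v. \<phi> (t + v)) - complex_integral \<nu> (\<lambda>v. \<phi> (- u + v))) \<in> {..\<epsilon>}}"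
        by (rule closedin_continuous_map_preimage) simp
      also have "{\<nu> \<in> topspace (hull_topology L).
          cmod (complex_integral \<nu> (\<lambda>v. \<phi> (t + v)) - complex_integral \<nu> (\<lambda>v. \<phi> (- u + v))) \<in> {..\<epsilon>}}
          = {\<nu> \<in> topspace (hull_topology L). ?P \<nu>}"
        by (auto simp: topspace_hull integral_translate \<phi>)
      finally show "closedin (hull_topology L) {\<nu> \<in> topspace (hull_topology L). ?P \<nu>}" .
    qed
    with u(1) show ?thesis by (intro bexI[of _ "- u"]) auto
  qed
  with F(1) show thesis by (intro that[of "uminus ` F"]) auto
qed

text \<open>If \<open>u\<close> is the representative of \<open>t\<close> for \<open>\<phi>\<close>, then the translates of \<open>x\<close> and \<open>y\<close> by \<open>t\<close> are as close for
  \<open>\<phi>\<close>, up to \<open>\<epsilon> / 2\<close>, as \<open>x\<close> and \<open>y\<close> are for \<open>\<phi>(u + v)\<close>; only finitely many such functions occur.\<close>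

lemma bohr_imp_equicontinuous:
  assumes bohr: "\<forall>\<phi>\<in>Cc. bohr_almost_periodic (\<lambda>t. \<Sum>\<^sub>\<infinity>x\<in>L. \<phi> (t - x))"
  shows "equicontinuous (hull_topology L) translate"
  unfolding equicontinuous_def
proof (intro conjI compact_hull Hausdorff_hull exI ballI)
  let ?X = "measure_hull L"
  show "compatible_uniformity (hull_topology L) (vague_uniformity ?X)"
    unfolding hull_topology_def by (rule compatible_vague_uniformity[OF hull_measures])
  fix V assume "V \<in> vague_uniformity ?X"
  then obtain \<Phi> \<epsilon> where V: "finite \<Phi>" "\<Phi> \<subseteq> Cc" "\<epsilon> > 0" "vague_entourage ?X \<Phi> \<epsilon> \<subseteq> V" "V \<subseteq> ?X \<times> ?X"
    by (rule vague_uniformityE)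
  have "\<forall>\<phi>\<in>\<Phi>. \<exists>F. finite F \<and> (\<forall>t. \<exists>u\<in>F. \<forall>\<nu>\<in>?X.
     cmod (complex_integral (translate t \<nu>) \<phi> - complex_integral (translate u \<nu>) \<phi>) \<le> \<epsilon> / 4)"
  proof
    fix \<phi> assume "\<phi> \<in> \<Phi>"
    then have \<phi>: "\<phi> \<in> Cc" using V(2) by blast
    have "\<epsilon> / 4 > 0" using V(3) by simp
    show "\<exists>F. finite F \<and> (\<forall>t. \<exists>u\<in>F. \<forall>\<nu>\<in>?X.
     cmod (complex_integral (translate t \<nu>) \<phi> - complex_integral (translate u \<nu>) \<phi>) \<le> \<epsilon> / 4)"
      by (rule hull_finite_translates[OF bohr \<phi> \<open>\<epsilon> / 4 > 0\<close>]) auto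
  qed
  then obtain F where F: "\<And>\<phi>. \<phi> \<in> \<Phi> \<Longrightarrow> finite (F \<phi>)"
      "\<And>\<phi> t. \<phi> \<in> \<Phi> \<Longrightarrow> \<exists>u\<in>F \<phi>. \<forall>\<nu>\<in>?X.
        cmod (complex_integral (translate t \<nu>) \<phi> - complex_integral (translate u \<nu>) \<phi>) \<le> \<epsilon> / 4"
    by metis
  define \<Psi> where "\<Psi> = (\<Union>\<phi>\<in>\<Phi>. (\<lambda>u v. \<phi> (u + v)) ` F \<phi>)"
  have \<Psi>: "finite \<Psi>" "\<Psi> \<subseteq> Cc"
    unfolding \<Psi>_def using V(1,2) F(1) by (auto intro!: Cc_translate)
  show "\<exists>U\<in>vague_uniformity ?X. \<forall>x y. (x, y) \<in> U \<longrightarrow> (\<forall>t. (translate t x, translate t y) \<in> V)"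
  proof (intro bexI[OF _ vague_entourage_in_uniformity[OF \<Psi>]] allI impI)
    show "\<epsilon> / 4 > 0" using V(3) by simp
    fix x y t assume xy: "(x, y) \<in> vague_entourage ?X \<Psi> (\<epsilon> / 4)"
    then have x: "x \<in> ?X" and y: "y \<in> ?X" by (auto simp: vague_entourage_def)
    have "cmod (complex_integral (translate t y) \<phi> - complex_integral (translate t x) \<phi>) < \<epsilon>"
      if \<phi>: "\<phi> \<in> \<Phi>" for \<phi>
    proof -
      have Cc: "\<phi> \<in> Cc" using \<phi> V(2) by blast
      obtain u where u: "u \<in> F \<phi>" "\<And>\<nu>. \<nu> \<in> ?X \<Longrightarrow>
          cmod (complex_integral (translate t \<nu>) \<phi> - complex_integral (translate u \<nu>) \<phi>) \<le> \<epsilon> / 4"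
        using F(2)[OF \<phi>, of t] by blast
      have "(\<lambda>v. \<phi> (u + v)) \<in> \<Psi>" using u(1) \<phi> by (auto simp: \<Psi>_def)
      then have "cmod (complex_integral (translate u y) \<phi> - complex_integral (translate u x) \<phi>) < \<epsilon> / 4"
        using xy by (auto simp: vague_entourage_def vague_ball_def integral_translate Cc)
      then show ?thesis
        using u(2)[OF x] u(2)[OF y] V(3)
          norm_triangle_ineq[of "complex_integral (translate t y) \<phi> - complex_integral (translate u y) \<phi>"
            "complex_integral (translate u y) \<phi> - complex_integral (translate u x) \<phi>"]
          norm_triangle_ineq4[of "complex_integral (translate t y) \<phi> - complex_integral (translate u x) \<phi>"
            "complex_integral (translate t x) \<phi> - complex_integral (translate u x) \<phi>"]
        by simp
    qed
    then have "(translate t x, translate t y) \<in> vague_entourage ?X \<Phi> \<epsilon>"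
      using translate_in_hull[OF x] translate_in_hull[OF y] hull_measures
      by (auto simp: vague_entourage_def vague_ball_def)
    then show "(translate t x, translate t y) \<in> V" using V(4) by blast
  qed
qed

lemma equicontinuous_imp_group:
  assumes "equicontinuous (hull_topology L) translate"
  shows "\<exists>H. compact_abelian_group (hull_topology L) H \<and> \<one>\<^bsub>H\<^esub> = delta L \<and>
    (\<forall>t s. delta ((+) t ` L) \<otimes>\<^bsub>H\<^esub> delta ((+) s ` L) = delta ((+) (s + t) ` L))"
proof -
  obtain \<U> where \<U>: "compatible_uniformity (hull_topology L) \<U>"
      "\<And>V. V \<in> \<U> \<Longrightarrow> \<exists>U\<in>\<U>. \<forall>x y. (x, y) \<in> U \<longrightarrow> (\<forall>t. (translate t x, translate t y) \<in> V)"
    using assms unfolding equicontinuous_def by metis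
  have "\<exists>U\<in>\<U>. \<forall>s s'. (orbit s, orbit s') \<in> U \<longrightarrow> (\<forall>t. (orbit (t + s), orbit (t + s')) \<in> V)"
    if V: "V \<in> \<U>" for V
  proof -
    obtain U where U: "U \<in> \<U>" "\<And>x y t. (x, y) \<in> U \<Longrightarrow> (translate t x, translate t y) \<in> V"
      using \<U>(2)[OF V] by metis
    then have "(orbit (t + s), orbit (t + s')) \<in> V" if "(orbit s, orbit s') \<in> U" for s s' t
      using U(2)[OF that, of t] by (simp add: translate_orbit)
    with U(1) show ?thesis by (intro bexI[of _ U]) auto
  qed
  then have "\<exists>H. compact_abelian_group (hull_topology L) H \<and> \<one>\<^bsub>H\<^esub> = orbit 0 \<and>
      (\<forall>t s. orbit t \<otimes>\<^bsub>H\<^esub> orbit s = orbit (s + t))"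
    using orbit_in_hull
    by (intro group_from_equicontinuous_orbit[OF compact_hull Hausdorff_hull \<U>(1) _ orbit_dense])
      (simp_all add: topspace_hull)
  moreover have "orbit 0 = delta L" by (simp add: orbit_def)
  ultimately show ?thesis by (simp add: orbit_def)
qed

lemma group_imp_bohr:
  assumes H: "compact_abelian_group (hull_topology L) H" and one: "\<one>\<^bsub>H\<^esub> = delta L"
    and mult: "\<forall>t s. delta ((+) t ` L) \<otimes>\<^bsub>H\<^esub> delta ((+) s ` L) = delta ((+) (s + t) ` L)"
    and \<phi>: "\<phi> \<in> Cc"
  shows "bohr_almost_periodic (\<lambda>t. \<Sum>\<^sub>\<infinity>x\<in>L. \<phi> (t - x))"
proof -
  define f where "f t = (\<Sum>\<^sub>\<infinity>x\<in>L. \<phi> (t - x))" for t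
  define \<Psi> where "\<Psi> \<nu> = complex_integral \<nu> (\<lambda>u. \<phi> (0 - u))" for \<nu>
  have f: "f t = \<Psi> (orbit (- t))" for t
    using orbit_integral[OF \<phi>, of t] by (simp add: f_def \<Psi>_def)
  have \<Psi>: "continuous_map (hull_topology L) euclidean \<Psi>"
    unfolding \<Psi>_def[abs_def] by (intro continuous_hull_integral Cc_reflect \<phi>)
  have "compactin euclidean (\<Psi> ` topspace (hull_topology L))"
    using compact_hull \<Psi> unfolding compact_space_def by (rule image_compactin)
  then have "bounded (\<Psi> ` topspace (hull_topology L))" by (simp add: compact_imp_bounded)
  then have bdd: "bounded (range f)"
    by (rule bounded_subset) (auto simp: f topspace_hull orbit_in_hull)
  have dense: "relatively_dense {t. (SUP s. cmod (f (s - t) - f s)) \<le> \<epsilon>}" if "\<epsilon> > 0" for \<epsilon>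
  proof -
    obtain F where F: "finite F" "\<And>t. \<exists>u\<in>F. \<forall>s. cmod (\<Psi> (orbit (s + (t - u))) - \<Psi> (orbit s)) < \<epsilon>"
    proof (rule compact_group_finite_translates[OF H _ orbit_dense _ _ \<Psi> \<open>\<epsilon> > 0\<close>])
      show "orbit t \<in> topspace (hull_topology L)" for t by (simp add: topspace_hull orbit_in_hull)
      show "\<one>\<^bsub>H\<^esub> = orbit 0" by (simp add: one orbit_def)
      show "orbit t \<otimes>\<^bsub>H\<^esub> orbit s = orbit (s + t)" for t s using mult by (simp add: orbit_def)
    qed (rule that)
    have "\<exists>r u. t = r + u \<and> (SUP s. cmod (f (s - r) - f s)) \<le> \<epsilon> \<and> u \<in> F" for t
    proof -
      obtain u where u: "u \<in> F" "\<And>s. cmod (\<Psi> (orbit (s + (t - u))) - \<Psi> (orbit s)) < \<epsilon>"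
        using F(2)[of t] by blast
      have "cmod (f (s - (t - u)) - f s) \<le> \<epsilon>" for s
        using u(2)[of "- s"] by (simp add: f algebra_simps less_imp_le)
      then have "(SUP s. cmod (f (s - (t - u)) - f s)) \<le> \<epsilon>" by (intro cSUP_least) auto
      with u(1) show ?thesis by (intro exI[of _ "t - u"] exI[of _ u]) auto
    qed
    then show ?thesis
      unfolding relatively_dense_def using finite_imp_compact[OF F(1)]
      by (intro exI[of _ F]) auto
  qed
  show ?thesis
    using continuous_orbit_function[OF \<phi>] bdd dense
    unfolding bohr_almost_periodic_def f_def[abs_def, symmetric] by blast
qed

end

theorem theorem4p2:
  fixes L :: "'g::{topological_ab_group_add, t2_space} set"
  assumes "locally_compact_space (euclidean :: 'g topology)"
    and "sigma_compact_space (euclidean :: 'g topology)"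
    and "delone L"
  shows
    "((\<forall>\<phi>\<in>Cc. bohr_almost_periodic (\<lambda>t. \<Sum>\<^sub>\<infinity>x\<in>L. \<phi> (t - x)))
        \<longleftrightarrow> strongly_almost_periodic (delta L)) \<and>
     (strongly_almost_periodic (delta L)
        \<longleftrightarrow> (\<exists>H. compact_abelian_group (hull_topology L) H \<and> \<one>\<^bsub>H\<^esub> = delta L \<and>
              (\<forall>t s. delta ((+) t ` L) \<otimes>\<^bsub>H\<^esub> delta ((+) s ` L) = delta ((+) (s + t) ` L)))) \<and>
     ((\<exists>H. compact_abelian_group (hull_topology L) H \<and> \<one>\<^bsub>H\<^esub> = delta L \<and>
              (\<forall>t s. delta ((+) t ` L) \<otimes>\<^bsub>H\<^esub> delta ((+) s ` L) = delta ((+) (s + t) ` L)))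
        \<longleftrightarrow> equicontinuous (hull_topology L) translate)"
proof -
  have "uniformly_discrete L" using assms(3) by (simp add: delone_def)
  then obtain V where "open V" "0 \<in> V" "separated_by V L" by (rule uniformly_discrete_separated)
  then interpret separated_set V L by unfold_locales (rule assms(1))
  show ?thesis
    using bohr_iff_strongly_almost_periodic bohr_imp_equicontinuous equicontinuous_imp_group group_imp_bohr
    by blast
qed

end
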